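(* Let $1\le p<\infty$ and let $w_1$ and $w_2$ be locally $p$-admissible weights on $\mathbf{R}$. Then $\max\{w_1,w_2\}$ and $\min\{w_1,w_2\}$ are locally $p$-admissible on $\mathbf{R}$. Moreover, for $p>1$, the weight $w_1^{1/(1-p)}$ is locally $p/(p-1)$-admissible on $\mathbf{R}$.
   Context: A measure on $\mathbf{R}$ means a positive complete Borel measure $\mu$ with $0<\mu(B)<\infty$ for every ball $B$. Balls $B=B(x,r)$ in $\mathbf{R}$ are the bounded open intervals $(x-r,x+r)$, with radius $r_B=r$, and $\lambda B=B(x,\lambda r)$. Write $u_B=\frac{1}{\mu(B)}\int_B u\,d\mu$. Upper gradient: a Borel function $g\ge 0$ on a metric space $Y$ is an upper gradient of $u:Y\to[-\infty,\infty]$ if $|u(\gamma(0))-u(\gamma(l_\gamma))|\le\int_\gamma g\,ds$ for every nonconstant compact rectifiable curve $\gamma:[0,l_\gamma]\to Y$ parameterized by arc length (the left-hand side is interpreted as $\infty$ if at least one of the two terms is $\pm\infty$). Let $1\le q<\infty$ and let $B_0$ be a ball in $\mathbf{R}$. - $\mu$ is doubling within $B_0$ if there is $C>0$ such that $\mu(2B)\le C\mu(B)$ for all balls $B\subset B_0$. - The $q$-Poincaré inequality holds within $B_0$ if there are $C>0$ and $\lambda\ge1$ such that for all balls $B\subset B_0$, all integrable functions $u$ on $\lambda B$ and all upper gradients $g$ of $u$ on $\lambda B$, $$\frac{1}{\mu(B)}\int_B|u-u_B|\,d\mu\le C r_B\Bigl(\frac{1}{\mu(\lambda B)}\int_{\lambda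 B}g^q\,d\mu\Bigr)^{1/q}.$$ - $\mu$ is $q$-admissible within $B_0$ if it is doubling and supports a $q$-Poincaré inequality within $B_0$. $\mu$ is locally $q$-admissible if for every $x\in\mathbf{R}$ there is $R_x>0$ such that $\mu$ is $q$-admissible within $B(x,R_x)$, with constants that may depend on $x$. A weight $w$ (nonnegative measurable function on $\mathbf{R}$) is locally $q$-admissible if $d\mu=w\,dx$ defines a locally $q$-admissible measure. *)

theory Defs
  imports "HOL-Analysis.Analysis"
begin

(* Real powers on [0,\<infinity>], with 0^a = \<infinity> and \<infinity>^a = 0 for a < 0 (whereas 0 powr a = 0). *)
definition ennreal_rpow :: "ennreal \<Rightarrow> real \<Rightarrow> ennreal" where
  "ennreal_rpow x a =
     (if a = 0 then 1
      else if x = 0 then (if a > 0 then 0 else \<infinity>)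
      else if x = \<infinity> then (if a > 0 then \<infinity> else 0)
      else ennreal (enn2real x powr a))"

definition curve_length :: "(real \<Rightarrow> 'a::metric_space) \<Rightarrow> real \<Rightarrow> real \<Rightarrow> ennreal" where
  "curve_length \<gamma> a b =
     (SUP ts \<in> {ts. sorted ts \<and> set ts \<subseteq> {a..b}}.
        \<Sum>i<length ts - 1. ennreal (dist (\<gamma> (ts ! i)) (\<gamma> (ts ! Suc i))))"

(* A nonconstant compact rectifiable curve [0,l] \<rightarrow> Y parameterized by arc length.
   Its length is l, so it is nonconstant iff l > 0. *)
definition arc_length_curve :: "'a::metric_space set \<Rightarrow> real \<Rightarrow> (real \<Rightarrow> 'a) \<Rightarrow> bool" where
  "arc_length_curve Y l \<gamma> \<longleftrightarrow>
     0 < l \<and> continuous_on {0..l} \<gamma> \<and> \<gamma> ` {0..l} \<subseteq> Y \<and>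
     (\<forall>s t. 0 \<le> s \<and> s \<le> t \<and> t \<le> l \<longrightarrow> curve_length \<gamma> s t = ennreal (t - s))"

(* Functions on the metric space Y are represented by functions on the whole type whose values
   outside Y are irrelevant. *)
definition upper_gradient ::
    "'a::metric_space set \<Rightarrow> ('a \<Rightarrow> ennreal) \<Rightarrow> ('a \<Rightarrow> ereal) \<Rightarrow> bool" where
  "upper_gradient Y g u \<longleftrightarrow>
     g \<in> borel_measurable (restrict_space borel Y) \<and>
     (\<forall>l \<gamma>. arc_length_curve Y l \<gamma> \<longrightarrow>
        (if \<bar>u (\<gamma> 0)\<bar> = \<infinity> \<or> \<bar>u (\<gamma> l)\<bar> = \<infinity> then \<infinity>
         else e2ennreal \<bar>u (\<gamma> 0) - u (\<gamma> l)\<bar>)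
        \<le> (\<integral>\<^sup>+t\<in>{0..l}. g (\<gamma> t) \<partial>lborel))"

definition ball_measure :: "real measure \<Rightarrow> bool" where
  "ball_measure M \<longleftrightarrow>
     complete_measure M \<and> space M = UNIV \<and> sets borel \<subseteq> sets M \<and>
     (\<forall>x r. 0 < r \<longrightarrow> 0 < emeasure M (ball x r) \<and> emeasure M (ball x r) < \<infinity>)"

(* u takes values in [-\<infinity>,\<infinity>]; integrable means measurable with finite integral of |u|. *)
definition integrable_on_set :: "real measure \<Rightarrow> real set \<Rightarrow> (real \<Rightarrow> ereal) \<Rightarrow> bool" where
  "integrable_on_set M A u \<longleftrightarrow>
     u \<in> borel_measurable (restrict_space M A) \<and> (\<integral>\<^sup>+y\<in>A. e2ennreal \<bar>u y\<bar> \<partial>M) < \<infinity>"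

(* real_of_ereal sends \<infinity> and -\<infinity> to 0, which for integrable u only affects a null set. *)
definition mean_value :: "real measure \<Rightarrow> real set \<Rightarrow> (real \<Rightarrow> ereal) \<Rightarrow> real" where
  "mean_value M B u = (1 / measure M B) * (LINT y:B|M. real_of_ereal (u y))"

definition doubling_within :: "real measure \<Rightarrow> real set \<Rightarrow> bool" where
  "doubling_within M B0 \<longleftrightarrow>
     (\<exists>C::real. 0 < C \<and>
       (\<forall>x r. 0 < r \<and> ball x r \<subseteq> B0 \<longrightarrow>
          emeasure M (ball x (2 * r)) \<le> ennreal C * emeasure M (ball x r)))"

definition poincare_within :: "real \<Rightarrow> real measure \<Rightarrow> real set \<Rightarrow> bool" where
  "poincare_within q M B0 \<longleftrightarrow>
     (\<exists>C \<Lambda>::real. 0 < C \<and> 1 \<le> \<Lambda> \<and>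
       (\<forall>x r u g. 0 < r \<and> ball x r \<subseteq> B0 \<and>
            integrable_on_set M (ball x (\<Lambda> * r)) u \<and> upper_gradient (ball x (\<Lambda> * r)) g u \<longrightarrow>
          (\<integral>\<^sup>+y\<in>ball x r. e2ennreal \<bar>u y - ereal (mean_value M (ball x r) u)\<bar> \<partial>M)
             / emeasure M (ball x r)
          \<le> ennreal (C * r) *
             ennreal_rpow
               ((\<integral>\<^sup>+y\<in>ball x (\<Lambda> * r). ennreal_rpow (g y) q \<partial>M) / emeasure M (ball x (\<Lambda> * r)))
               (1 / q)))"

definition admissible_within :: "real \<Rightarrow> real measure \<Rightarrow> real set \<Rightarrow> bool" where
  "admissible_within q M B0 \<longleftrightarrow> doubling_within M B0 \<and> poincare_within q M B0"

definition locally_admissible :: "real \<Rightarrow> real measure \<Rightarrow> bool" where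
  "locally_admissible q M \<longleftrightarrow>
     ball_measure M \<and> (\<forall>x. \<exists>R>0. admissible_within q M (ball x R))"

(* Weights may take the value \<infinity>, so that negative powers of weights with zeros are again weights.
   The completion matters only if w vanishes on a set of positive Lebesgue measure. *)
definition locally_admissible_weight :: "real \<Rightarrow> (real \<Rightarrow> ennreal) \<Rightarrow> bool" where
  "locally_admissible_weight q w \<longleftrightarrow>
     w \<in> borel_measurable lebesgue \<and> locally_admissible q (completion (density lebesgue w))"

end

theory Submission
  imports Defs
begin

text \<open>
  Local $p$-admissibility of a weight $w$ is equivalent to the local Muckenhoupt condition, which is
  used in the form $(\int_B g)^p \int_B w \le C r^p \int_B g^p w$ for all $g \ge 0$. This form makes sense for all $p \ge 1$, so that $p = 1$ needs no separate treatment, and it implies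
  doubling (take $g$ to be the indicator of $B$ inside $2B$) and the Poincare inequality with dilation
  $1$ (if $g$ is an upper gradient of $u$, then $u$ oscillates on $B$ by at most $\int_B g$).
  Conversely, given $g$ on $B$, apply the Poincare inequality on $3B$ to the primitive $u$ of $g$:
  it vanishes on the left third of $3B$ and equals $\int_B g$ on the right third, and by doubling both
  thirds carry a fixed part of the measure of $3B$.

  The condition passes to $\max\{w_1,w_2\}$ because this weight is at most $w_1+w_2$, and to
  $\min\{w_1,w_2\}$ by splitting $g$ according to which of the two weights is smaller. For
  $\sigma = w^{1/(1-p)}$, inserting truncations of $\sigma$ for $g$ gives
  $(\int_B \sigma)^{p-1} \int_B w \le C r^p$, and a Hoelder-type estimate turns this into the condition
  for $\sigma$ with the conjugate exponent.
\<close>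

section \<open>Real powers of extended nonnegative reals\<close>

text \<open>The quantifier over all arc-length curves weighs on one direction only. To bound the
  oscillation of u by a given upper gradient, unit speed segments suffice. To show that g is an
  upper gradient of its primitive, every curve counts, including those that turn back infinitely
  often, and g is merely Borel with values in [0,\<infinity>]. Therefore Lebesgue measure on the
  time interval is pushed forward along the curve and compared with length as a measure; this costs
  only the intermediate value theorem and the Lipschitz bound.

  Weights and test functions may be 0 or infinite. The Muckenhoupt inequality is kept as a product,
  which makes sense for all such values; but taking a primitive and cancelling a common factor
  require finite integrals, hence the truncations.

  Admissibility is local, whereas every ball, however large, must have positive finite measure. The
  minimum has positive integrals because each weight is positive a.e. (test the condition on its
  zero set). The dual weight has positive integrals because w is finite a.e., and finite ones by
  compactness.\<close>

lemma ennreal_rpow_zero [simp]: "0 < a \<Longrightarrow> ennreal_rpow 0 a = 0"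
  by (simp add: ennreal_rpow_def)

lemma ennreal_rpow_top [simp]: "0 < a \<Longrightarrow> ennreal_rpow top a = top"
  by (simp add: ennreal_rpow_def)

lemma ennreal_rpow_one [simp]: "ennreal_rpow x 1 = x"
  by (cases x) (auto simp: ennreal_rpow_def)

lemma ennreal_rpow_ennreal: "0 < r \<Longrightarrow> ennreal_rpow (ennreal r) a = ennreal (r powr a)"
  by (auto simp: ennreal_rpow_def ennreal_eq_0_iff)

lemma ennreal_zero_top_cases:
  obtains "x = (0::ennreal)" | "x = top" | r where "x = ennreal r" "0 < r"
  by (metis ennreal_0 ennreal_cases infinity_ennreal_def less_eq_real_def)

lemma ennreal_rpow_mono:
  assumes "0 < a" "x \<le> y"
  shows "ennreal_rpow x a \<le> ennreal_rpow y a"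
  using assms
  by (cases x rule: ennreal_zero_top_cases; cases y rule: ennreal_zero_top_cases)
     (auto simp: ennreal_rpow_ennreal top_unique intro!: ennreal_leI powr_mono2)

lemma ennreal_rpow_mult:
  assumes "0 < a"
  shows "ennreal_rpow (x * y) a = ennreal_rpow x a * ennreal_rpow y a"
proof (cases x rule: ennreal_zero_top_cases; cases y rule: ennreal_zero_top_cases)
  fix r s :: real assume "x = ennreal r" "0 < r" "y = ennreal s" "0 < s"
  then show ?thesis
    by (simp add: ennreal_rpow_ennreal powr_mult flip: ennreal_mult)
qed (use assms in \<open>auto simp: ennreal_rpow_ennreal ennreal_top_mult ennreal_mult_top ennreal_eq_0_iff\<close>)

lemma ennreal_rpow_rpow:
  assumes "a \<noteq> 0" "b \<noteq> 0"
  shows "ennreal_rpow (ennreal_rpow x a) b = ennreal_rpow x (a * b)"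
proof (cases x rule: ennreal_zero_top_cases)
  case (3 r)
  then show ?thesis by (simp add: ennreal_rpow_ennreal powr_powr)
qed (use assms in \<open>auto simp: ennreal_rpow_def zero_less_mult_iff\<close>)

lemma ennreal_rpow_add:
  assumes "0 < a" "0 < b"
  shows "ennreal_rpow x (a + b) = ennreal_rpow x a * ennreal_rpow x b"
proof (cases x rule: ennreal_zero_top_cases)
  case (3 r)
  then show ?thesis by (simp add: ennreal_rpow_ennreal powr_add flip: ennreal_mult)
qed (use assms in \<open>auto simp: ennreal_top_mult\<close>)

lemma ennreal_rpow_le_iff:
  assumes "0 < a"
  shows "ennreal_rpow x a \<le> y \<longleftrightarrow> x \<le> ennreal_rpow y (1 / a)"
proof
  assume "ennreal_rpow x a \<le> y"
  from ennreal_rpow_mono[OF _ this, of "1 / a"] assms show "x \<le> ennreal_rpow y (1 / a)"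
    by (simp add: ennreal_rpow_rpow)
next
  assume "x \<le> ennreal_rpow y (1 / a)"
  from ennreal_rpow_mono[OF assms this] assms show "ennreal_rpow x a \<le> y"
    by (simp add: ennreal_rpow_rpow)
qed

lemma ennreal_rpow_eq_0_iff: "0 < a \<Longrightarrow> ennreal_rpow x a = 0 \<longleftrightarrow> x = 0"
  by (cases x rule: ennreal_zero_top_cases) (auto simp: ennreal_rpow_ennreal ennreal_eq_0_iff)

lemma measurable_ennreal_rpow [measurable (raw)]:
  assumes [measurable]: "f \<in> borel_measurable M"
  shows "(\<lambda>x. ennreal_rpow (f x) a) \<in> borel_measurable M"
  unfolding ennreal_rpow_def by measurable

text \<open>Bounding the sum by twice the larger term gives the constant without convexity.\<close>

lemma ennreal_rpow_add_le:
  assumes "0 < a"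
  shows "ennreal_rpow (x + y) a \<le> ennreal (2 powr a) * (ennreal_rpow x a + ennreal_rpow y a)"
proof -
  have "x + y \<le> 2 * max x y"
    by (metis add_mono max.cobounded1 max.cobounded2 mult_2)
  then have "ennreal_rpow (x + y) a \<le> ennreal_rpow (2 * max x y) a"
    by (rule ennreal_rpow_mono[OF assms])
  also have "\<dots> = ennreal (2 powr a) * ennreal_rpow (max x y) a"
    using ennreal_rpow_ennreal[of 2 a] by (simp add: ennreal_rpow_mult assms)
  also have "\<dots> \<le> ennreal (2 powr a) * (ennreal_rpow x a + ennreal_rpow y a)"
    by (intro mult_left_mono) (auto simp: max_def)
  finally show ?thesis .
qed

text \<open>Passage between the Poincare form, an average under a root, and the Muckenhoupt form, a
  product. A constant c there becomes \<open>c powr a\<close> here.\<close>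

lemma ennreal_le_mult_rpow_iff:
  assumes "0 < a" "0 < c" "0 < m" "m < top"
  shows "G \<le> ennreal c * ennreal_rpow (K / m) (1 / a) \<longleftrightarrow>
         ennreal_rpow G a * m \<le> ennreal (c powr a) * K"
proof -
  have "ennreal c * ennreal_rpow (K / m) (1 / a) = ennreal_rpow (ennreal (c powr a) * (K / m)) (1 / a)"
    using assms by (simp add: ennreal_rpow_mult ennreal_rpow_ennreal powr_powr)
  then have "G \<le> ennreal c * ennreal_rpow (K / m) (1 / a) \<longleftrightarrow> ennreal_rpow G a \<le> ennreal (c powr a) * K / m"
    using assms(1) by (simp add: ennreal_rpow_le_iff ennreal_times_divide)
  also have "\<dots> \<longleftrightarrow> ennreal_rpow G a * m \<le> ennreal (c powr a) * K"
    using assms divide_less_ennreal[of m "ennreal (c powr a) * K" "ennreal_rpow G a"] by (auto simp: not_less [symmetric])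
  finally show ?thesis .
qed

lemma inverse_antimono_ennreal:
  fixes x y :: ennreal
  assumes "x \<le> y"
  shows "inverse y \<le> inverse x"
  using assms
  by (cases x rule: ennreal_zero_top_cases; cases y rule: ennreal_zero_top_cases)
     (auto simp: inverse_ennreal top_unique intro!: ennreal_leI le_imp_inverse_le)

section \<open>Curves on the line\<close>

lemma arc_length_curve_lipschitz:
  assumes "arc_length_curve Y l c" "0 \<le> s" "s \<le> t" "t \<le> l"
  shows "dist (c s) (c t) \<le> t - s"
proof -
  have "ennreal (dist (c s) (c t)) \<le> curve_length c s t"
    unfolding curve_length_def
    by (rule SUP_upper2[of "[s, t]"]) (use assms in auto)
  also have "\<dots> = ennreal (t - s)"
    using assms by (auto simp: arc_length_curve_def)
  finally show ?thesis using assms by simp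
qed

lemma curve_length_translation:
  fixes x :: real
  assumes "s \<le> t"
  shows "curve_length (\<lambda>r. x + r) s t = ennreal (t - s)"
proof (rule antisym)
  have tel: "(\<Sum>i<length ts - 1. dist (x + ts ! i) (x + ts ! Suc i)) \<le> t - s"
    if ts: "sorted ts" "set ts \<subseteq> {s..t}" for ts
  proof (cases "ts = []")
    case False
    have "(\<Sum>i<length ts - 1. dist (x + ts ! i) (x + ts ! Suc i))
        = (\<Sum>i<length ts - 1. ts ! Suc i - ts ! i)"
      using ts by (intro sum.cong) (auto simp: dist_real_def sorted_iff_nth_Suc)
    also have "\<dots> = ts ! (length ts - 1) - ts ! 0"
      by (rule sum_lessThan_telescope)
    also have "\<dots> \<le> t - s"
    proof -
      have "ts ! (length ts - 1) \<in> set ts" "ts ! 0 \<in> set ts"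
        using False by (auto intro!: nth_mem)
      then have "ts ! (length ts - 1) \<le> t" "s \<le> ts ! 0"
        using ts(2) by auto
      then show ?thesis by simp
    qed
    finally show ?thesis .
  qed (use assms in auto)
  show "curve_length (\<lambda>r. x + r) s t \<le> ennreal (t - s)"
    unfolding curve_length_def
    by (rule SUP_least) (use tel in \<open>auto simp: sum_ennreal intro!: ennreal_leI\<close>)
  show "ennreal (t - s) \<le> curve_length (\<lambda>r. x + r) s t"
    unfolding curve_length_def
    by (rule SUP_upper2[of "[s, t]"]) (use assms in \<open>auto simp: dist_real_def\<close>)
qed

text \<open>These segments are the only curves on which a given upper gradient is tested.\<close>

lemma arc_length_curve_translation:
  fixes x :: real
  assumes "0 < l" "{x..x + l} \<subseteq> Y"
  shows "arc_length_curve Y l (\<lambda>r. x + r)"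
  unfolding arc_length_curve_def
proof (intro conjI allI impI)
  show "(\<lambda>r. x + r) ` {0..l} \<subseteq> Y"
    using assms(2) by auto
qed (use assms(1) in \<open>auto simp: curve_length_translation intro!: continuous_intros\<close>)

text \<open>The curve may oscillate, so the times spent in [a,b] need not form an interval. Take for
  t the first time at level b and for s the last time before t at level a. By the intermediate value
  theorem, leaving [a,b] between s and t would produce an earlier visit to b or a later one to a.
  The Lipschitz bound then yields the duration.\<close>

lemma lipschitz_curve_subinterval:
  fixes c :: "real \<Rightarrow> real"
  assumes "0 \<le> l" and cont: "continuous_on {0..l} c"
    and lip: "\<And>s t. 0 \<le> s \<Longrightarrow> s \<le> t \<Longrightarrow> t \<le> l \<Longrightarrow> \<bar>c s - c t\<bar> \<le> t - s"
    and a: "c 0 \<le> a" and ab: "a \<le> b" and b: "b \<le> c l"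
  obtains s t where "0 \<le> s" "s \<le> t" "t \<le> l" "b - a \<le> t - s" "c ` {s..t} \<subseteq> {a..b}"
proof -
  have level: "compact ({p..q} \<inter> c -` {y})" if "0 \<le> p" "q \<le> l" for p q y
  proof -
    have "continuous_on {p..q} c" using that by (intro continuous_on_subset[OF cont]) auto
    then have "closed ({p..q} \<inter> c -` {y})" by (intro continuous_closed_preimage) auto
    then show ?thesis by (meson bounded_closed_interval bounded_subset compact_eq_bounded_closed inf_le1)
  qed
  have ivt: "\<exists>r\<in>{p..q}. c r = y" if "0 \<le> p" "p \<le> q" "q \<le> l" "c p \<le> y" "y \<le> c q" for p q y
    using IVT'[of c p y q] continuous_on_subset[OF cont, of "{p..q}"] that by force
  have "\<exists>r\<in>{0..l}. c r = b"
    using assms(1) a ab b by (intro ivt) simp_all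
  then have "{0..l} \<inter> c -` {b} \<noteq> {}" by blast
  from compact_attains_inf[OF level[OF order_refl order_refl] this] obtain t
    where t: "t \<in> {0..l}" "c t = b" and tmin: "\<And>r. r \<in> {0..l} \<Longrightarrow> c r = b \<Longrightarrow> t \<le> r"
    by blast
  have "\<exists>r\<in>{0..t}. c r = a"
    using t a ab by (intro ivt) simp_all
  then have "{0..t} \<inter> c -` {a} \<noteq> {}" by blast
  from compact_attains_sup[OF level this] obtain s
    where s: "s \<in> {0..t}" "c s = a" and smax: "\<And>r. r \<in> {0..t} \<Longrightarrow> c r = a \<Longrightarrow> r \<le> s"
    using t(1) by auto
  have "a \<le> c r" if r: "r \<in> {s..t}" for r
  proof (rule ccontr)
    assume *: "\<not> a \<le> c r"
    have "\<exists>r'\<in>{r..t}. c r' = a"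
      using * r s(1) t ab by (intro ivt) simp_all
    then obtain r' where r': "r' \<in> {r..t}" "c r' = a" by blast
    then have "r' \<le> s" using smax[of r'] r s(1) by simp
    then have "r' = r" using r r' by simp
    with * r' show False by simp
  qed
  moreover have "c r \<le> b" if r: "r \<in> {s..t}" for r
  proof (rule ccontr)
    assume *: "\<not> c r \<le> b"
    have "\<exists>r'\<in>{0..r}. c r' = b"
      using * r s(1) t a ab by (intro ivt) simp_all
    then obtain r' where r': "r' \<in> {0..r}" "c r' = b" by blast
    then have "t \<le> r'" using tmin[of r'] r t(1) by simp
    then have "r' = r" using r r' by simp
    with * r' show False by simp
  qed
  moreover have "b - a \<le> t - s"
    using lip[of s t] s t by simp
  ultimately show ?thesis
    using s(1) t(1) by (intro that[of s t]) auto
qed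

text \<open>On an open interval the inequality holds because some subarc of the curve crosses it in time at
  least its length; outer regularity of the image measure extends it to Borel sets.\<close>

lemma emeasure_lipschitz_curve_ge:
  fixes c :: "real \<Rightarrow> real"
  assumes l: "0 \<le> l" and cont: "continuous_on {0..l} c"
    and lip: "\<And>s t. 0 \<le> s \<Longrightarrow> s \<le> t \<Longrightarrow> t \<le> l \<Longrightarrow> \<bar>c s - c t\<bar> \<le> t - s"
    and E: "E \<in> sets borel"
  shows "emeasure lborel (E \<inter> {c 0<..<c l}) \<le> emeasure (distr (restrict_space lborel {0..l}) borel c) E"
proof -
  have cm: "c \<in> restrict_space lborel {0..l} \<rightarrow>\<^sub>M borel"
    using borel_measurable_continuous_on_restrict[OF cont]
    by (simp cong: measurable_cong_sets sets_restrict_space_cong)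
  define \<nu> where "\<nu> = distr (restrict_space lborel {0..l}) borel c"
  have sets_\<nu>: "sets \<nu> = sets borel" and space_\<nu>: "space \<nu> = UNIV" by (simp_all add: \<nu>_def)
  have \<nu>_eq: "emeasure \<nu> A = emeasure lborel (c -` A \<inter> {0..l})" if "A \<in> sets borel" for A
    using that cm by (simp add: \<nu>_def emeasure_distr emeasure_restrict_space space_restrict_space)
  \<comment> \<open>The outer regularity used below is that of a finite Borel measure; here the
    total mass is l.\<close>
  have "emeasure \<nu> (space \<nu>) \<noteq> \<infinity>" by (simp add: space_\<nu> \<nu>_eq l)
  have comp: "emeasure lborel V \<le> emeasure \<nu> V"
    if V: "open V" "connected V" "V \<subseteq> {c 0<..<c l}" for V
  proof (cases "V = {}")
    case False
    have bdd: "bdd_below V" "bdd_above V"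
      using V(3) by (auto intro: bdd_below_mono bdd_above_mono)
    \<comment> \<open>The subarc lemma speaks of closed intervals, so the open interval V is
      exhausted from inside by [p,q], at a loss of at most e.\<close>
    have "ennreal (Sup V - Inf V) \<le> emeasure \<nu> V + ennreal e" if e: "0 < e" for e
    proof -
      obtain p where p: "p \<in> V" "p < Inf V + e / 2"
        using cInf_lessD[OF False, of "Inf V + e / 2"] e by auto
      obtain q where q: "q \<in> V" "Sup V - e / 2 < q"
        using less_cSupD[OF False, of "Sup V - e / 2"] e by auto
      show ?thesis
      proof (cases "p \<le> q")
        case True
        obtain s t where st: "0 \<le> s" "s \<le> t" "t \<le> l" "q - p \<le> t - s" "c ` {s..t} \<subseteq> {p..q}"
        proof (rule lipschitz_curve_subinterval[OF l cont lip _ True])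
          show "c 0 \<le> p" "q \<le> c l" using p(1) q(1) V(3) by auto
        qed
        have "{p..q} \<subseteq> V"
          using V(2) p q by (simp add: connected_contains_Icc)
        with st(5) have "c ` {s..t} \<subseteq> V" by (rule order_trans)
        with st(1,3) have "{s..t} \<subseteq> c -` V \<inter> {0..l}" by auto
        moreover have "c -` V \<inter> {0..l} \<in> sets lborel"
          using measurable_sets[OF cm, of V] V(1) by (simp add: sets_restrict_space_iff space_restrict_space)
        ultimately have "emeasure lborel {s..t} \<le> emeasure \<nu> V"
          using V(1) by (subst \<nu>_eq) (auto intro: emeasure_mono)
        moreover have "ennreal (Sup V - Inf V) \<le> ennreal ((t - s) + e)"
          using p q st by (intro ennreal_leI) linarith
        then have "ennreal (Sup V - Inf V) \<le> emeasure lborel {s..t} + ennreal e"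
          using st e by simp
        ultimately show ?thesis
          by (meson add_right_mono order_trans)
      next
        case False
        then have "Sup V - Inf V \<le> e" using p q by simp
        then have "ennreal (Sup V - Inf V) \<le> ennreal e" by (rule ennreal_leI)
        then show ?thesis by (simp add: add_increasing)
      qed
    qed
    then have "ennreal (Sup V - Inf V) \<le> emeasure \<nu> V"
      by (rule ennreal_le_epsilon)
    moreover have "emeasure lborel V \<le> emeasure lborel {Inf V..Sup V}"
      using bdd by (intro emeasure_mono) (auto intro: cInf_lower cSup_upper)
    moreover have "Inf V \<le> Sup V" using cInf_le_cSup[OF False] bdd by auto
    ultimately show ?thesis by simp
  qed simp
  \<comment> \<open>An open set is the disjoint union of its countably many components, so the bound
    for intervals adds up.\<close>
  have op: "emeasure lborel U \<le> emeasure \<nu> U" if U: "open U" "U \<subseteq> {c 0<..<c l}" for U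
  proof -
    have cnt: "countable (components U)"
      using U(1) by (intro countable_disjoint_open_subsets)
        (auto intro: open_components simp: pairwise_def disjnt_def components_nonoverlap)
    have disj: "disjoint_family_on (\<lambda>V. V) (components U)"
      by (auto simp: disjoint_family_on_def dest: components_nonoverlap)
    have bor: "V \<in> sets borel" if "V \<in> components U" for V
      using open_components[OF U(1) that] by simp
    have "emeasure lborel U = emeasure lborel (\<Union>V\<in>components U. V)"
      by (simp add: Union_components)
    also have "\<dots> = (\<integral>\<^sup>+V. emeasure lborel V \<partial>count_space (components U))"
      using bor cnt disj by (intro emeasure_UN_countable) auto
    also have "\<dots> \<le> (\<integral>\<^sup>+V. emeasure \<nu> V \<partial>count_space (components U))"
      using U(2) in_components_subset
      by (intro nn_integral_mono comp) (auto intro: open_components[OF U(1)] in_components_connected)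
    also have "\<dots> = emeasure \<nu> (\<Union>V\<in>components U. V)"
      using bor cnt disj by (intro emeasure_UN_countable[symmetric]) (auto simp: sets_\<nu>)
    also have "\<dots> = emeasure \<nu> U"
      by (simp add: Union_components)
    finally show ?thesis .
  qed
  have "emeasure \<nu> (E \<inter> {c 0<..<c l}) = (INF U \<in> {U. E \<inter> {c 0<..<c l} \<subseteq> U \<and> open U}. emeasure \<nu> U)"
    using outer_regular[of \<nu> "E \<inter> {c 0<..<c l}"] sets_\<nu> E \<open>emeasure \<nu> (space \<nu>) \<noteq> \<infinity>\<close> by simp
  also have "\<dots> \<ge> emeasure lborel (E \<inter> {c 0<..<c l})"
  proof (rule INF_greatest)
    fix U assume U: "U \<in> {U. E \<inter> {c 0<..<c l} \<subseteq> U \<and> open U}"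
    have "emeasure lborel (E \<inter> {c 0<..<c l}) \<le> emeasure lborel (U \<inter> {c 0<..<c l})"
      using U by (intro emeasure_mono) auto
    also have "\<dots> \<le> emeasure \<nu> (U \<inter> {c 0<..<c l})"
      using U by (intro op) auto
    also have "\<dots> \<le> emeasure \<nu> U"
      using U by (intro emeasure_mono) (auto simp: sets_\<nu>)
    finally show "emeasure lborel (E \<inter> {c 0<..<c l}) \<le> emeasure \<nu> U" .
  qed
  finally have "emeasure lborel (E \<inter> {c 0<..<c l}) \<le> emeasure \<nu> (E \<inter> {c 0<..<c l})" .
  also have "\<dots> \<le> emeasure \<nu> E"
    using E by (intro emeasure_mono) (auto simp: sets_\<nu>)
  finally show ?thesis by (simp add: \<nu>_def)
qed

lemma nn_integral_le_lipschitz_curve_aux: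
  fixes c :: "real \<Rightarrow> real"
  assumes l: "0 \<le> l" and cont: "continuous_on {0..l} c"
    and lip: "\<And>s t. 0 \<le> s \<Longrightarrow> s \<le> t \<Longrightarrow> t \<le> l \<Longrightarrow> \<bar>c s - c t\<bar> \<le> t - s"
    and g [measurable]: "g \<in> borel_measurable borel"
  shows "(\<integral>\<^sup>+y\<in>{c 0<..<c l}. g y \<partial>lborel) \<le> (\<integral>\<^sup>+t\<in>{0..l}. g (c t) \<partial>lborel)"
proof -
  have cm: "c \<in> restrict_space lborel {0..l} \<rightarrow>\<^sub>M borel"
    using borel_measurable_continuous_on_restrict[OF cont]
    by (simp cong: measurable_cong_sets sets_restrict_space_cong)
  let ?\<mu> = "density lborel (indicator {c 0<..<c l})"
  let ?\<nu> = "distr (restrict_space lborel {0..l}) borel c"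
  \<comment> \<open>For measures with the same measurable sets the order is the pointwise order of
    \<open>emeasure\<close> as a function on all sets, hence the trivial case of non-Borel
    sets.\<close>
  have "emeasure ?\<mu> E \<le> emeasure ?\<nu> E" for E
  proof (cases "E \<in> sets borel")
    case True
    then show ?thesis
      using emeasure_lipschitz_curve_ge[OF l cont lip True] by (simp add: emeasure_restricted Int_commute)
  qed (simp add: emeasure_notin_sets)
  then have "?\<mu> \<le> ?\<nu>"
    by (simp add: le_measure_iff le_fun_def)
  have "(\<integral>\<^sup>+y\<in>{c 0<..<c l}. g y \<partial>lborel) = (\<integral>\<^sup>+y. g y \<partial>?\<mu>)"
    by (simp add: nn_integral_density mult.commute)
  also have "\<dots> \<le> (\<integral>\<^sup>+y. g y \<partial>?\<nu>)"
    using \<open>?\<mu> \<le> ?\<nu>\<close> by (intro nn_integral_mono_measure) simp_all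
  also have "\<dots> = (\<integral>\<^sup>+t\<in>{0..l}. g (c t) \<partial>lborel)"
    using cm by (simp add: nn_integral_distr nn_integral_restrict_space)
  finally show ?thesis .
qed

text \<open>A curve that ends to the left of its starting point is reduced to the previous case by
  the reflection y -> -y.\<close>

lemma nn_integral_le_lipschitz_curve:
  fixes c :: "real \<Rightarrow> real"
  assumes l: "0 \<le> l" and cont: "continuous_on {0..l} c"
    and lip: "\<And>s t. 0 \<le> s \<Longrightarrow> s \<le> t \<Longrightarrow> t \<le> l \<Longrightarrow> \<bar>c s - c t\<bar> \<le> t - s"
    and g [measurable]: "g \<in> borel_measurable borel"
  shows "(\<integral>\<^sup>+y\<in>{min (c 0) (c l)<..<max (c 0) (c l)}. g y \<partial>lborel) \<le> (\<integral>\<^sup>+t\<in>{0..l}. g (c t) \<partial>lborel)"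
proof (cases "c 0 \<le> c l")
  case True
  then show ?thesis
    using nn_integral_le_lipschitz_curve_aux[OF l cont lip g] by simp
next
  case False
  have "(\<integral>\<^sup>+y\<in>{c l<..<c 0}. g y \<partial>lborel) = (\<integral>\<^sup>+y. g (- y) * indicator {c l<..<c 0} (- y) \<partial>lborel)"
    using nn_integral_real_affine[of "\<lambda>y. g y * indicator {c l<..<c 0} y" "-1" 0] by simp
  also have "\<dots> = (\<integral>\<^sup>+y\<in>{- c 0<..<- c l}. g (- y) \<partial>lborel)"
    by (intro nn_integral_cong) (auto simp: indicator_def)
  also have "\<dots> \<le> (\<integral>\<^sup>+t\<in>{0..l}. g (- (- c t)) \<partial>lborel)"
  proof (rule nn_integral_le_lipschitz_curve_aux)
    show "\<bar>- c s - - c t\<bar> \<le> t - s" if "0 \<le> s" "s \<le> t" "t \<le> l" for s t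
      using lip[OF that] by simp
  qed (use l cont in \<open>auto intro: continuous_intros\<close>)
  finally show ?thesis using False by simp
qed

section \<open>Sufficiency of the Muckenhoupt condition\<close>

text \<open>On the line the segment between two points of a ball is a curve in the ball. The points
  are distinct because curves are nonconstant; for equal points with u infinite the left side would
  be infinite.\<close>

lemma upper_gradient_diff_le:
  fixes u :: "real \<Rightarrow> ereal"
  assumes ug: "upper_gradient (ball z r) g u" and xy: "x \<in> ball z r" "y \<in> ball z r" "x \<noteq> y"
  shows "(if \<bar>u x\<bar> = \<infinity> \<or> \<bar>u y\<bar> = \<infinity> then \<infinity> else e2ennreal \<bar>u x - u y\<bar>)
           \<le> (\<integral>\<^sup>+t\<in>ball z r. g t \<partial>lborel)"
    (is "?d x y \<le> ?I")
proof -
  have gm: "(\<lambda>t. g t * indicator (ball z r) t) \<in> borel_measurable borel"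
    using ug by (simp add: upper_gradient_def borel_measurable_restrict_space_iff_ennreal)
  have *: "?d x y \<le> ?I" if "x < y" "x \<in> ball z r" "y \<in> ball z r" for x y
  proof -
    have sub: "{x..y} \<subseteq> ball z r"
      using that by (auto simp: dist_real_def)
    then have "arc_length_curve (ball z r) (y - x) (\<lambda>t. x + t)"
      using that by (intro arc_length_curve_translation) auto
    then have "?d x y \<le> (\<integral>\<^sup>+t\<in>{0..y - x}. g (x + t) \<partial>lborel)"
      using ug unfolding upper_gradient_def by (elim conjE allE impE) auto
    also have "\<dots> \<le> (\<integral>\<^sup>+t. g (x + t) * indicator (ball z r) (x + t) \<partial>lborel)"
    proof (rule nn_integral_mono)
      fix t
      show "g (x + t) * indicator {0..y - x} t \<le> g (x + t) * indicator (ball z r) (x + t)"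
        using subsetD[OF sub, of "x + t"] by (simp add: indicator_def)
    qed
    also have "\<dots> = ?I"
      using nn_integral_real_affine[OF gm, of 1 x] by simp
    finally show ?thesis .
  qed
  show ?thesis
  proof (cases "x < y")
    case True
    then show ?thesis using * xy by blast
  next
    case False
    then have "?d y x \<le> ?I" using * xy by (meson linorder_neqE)
    moreover have "\<bar>u x - u y\<bar> = \<bar>u y - u x\<bar>"
      by (cases "u x"; cases "u y") auto
    ultimately show ?thesis by (auto split: if_splits)
  qed
qed

text \<open>Integrating v y - d <= v <= v y + d over B shows that the mean is within d of every
  value, not only on average. Finiteness of u is asked only when G is finite, since for infinite G
  the claim is trivial.\<close>

lemma mean_oscillation_le:
  assumes B: "B \<in> sets M" and m: "0 < emeasure M B" "emeasure M B < \<infinity>"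
    and u: "integrable_on_set M B u"
    and fin: "\<And>y. G < \<infinity> \<Longrightarrow> y \<in> B \<Longrightarrow> \<bar>u y\<bar> \<noteq> \<infinity>"
    and osc: "\<And>x y. x \<in> B \<Longrightarrow> y \<in> B \<Longrightarrow> e2ennreal \<bar>u x - u y\<bar> \<le> G"
  shows "(\<integral>\<^sup>+y\<in>B. e2ennreal \<bar>u y - ereal (mean_value M B u)\<bar> \<partial>M) / emeasure M B \<le> G"
proof (cases G)
  case (real d)
  define v where "v = (\<lambda>y. real_of_ereal (u y))"
  have uv: "u y = ereal (v y)" if "y \<in> B" for y
    using fin[of y] real that by (simp add: v_def ereal_real)
  have vv: "\<bar>v x - v y\<bar> \<le> d" if "x \<in> B" "y \<in> B" for x y
    using osc[OF that] real by (simp add: uv that)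
  define m where "m = measure M B"
  have m1: "emeasure M B = ennreal m"
    using m by (simp add: m_def emeasure_eq_ennreal_measure)
  then have m0: "0 < m" using m by simp
  have "v \<in> borel_measurable (restrict_space M B)"
    using u unfolding integrable_on_set_def v_def by (intro borel_measurable_real_of_ereal) simp
  then have vm: "(\<lambda>y. indicator B y *\<^sub>R v y) \<in> borel_measurable M"
    using B by (simp add: borel_measurable_restrict_space_iff sets.Int_space_eq1 sets.sets_into_space)
  have "(\<integral>\<^sup>+y. ennreal (norm (indicator B y *\<^sub>R v y)) \<partial>M) = (\<integral>\<^sup>+y\<in>B. e2ennreal \<bar>u y\<bar> \<partial>M)"
    by (intro nn_integral_cong) (auto simp: uv split: split_indicator)
  then have int: "set_integrable M B v"
    using vm u by (simp add: set_integrable_def integrable_iff_bounded integrable_on_set_def)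
  have const: "set_integrable M B (\<lambda>_. k)" "(LINT y:B|M. k) = k * m" for k :: real
    using B m by (simp_all add: set_integrable_def set_lebesgue_integral_def m_def)
  define a where "a = mean_value M B u"
  have am: "a * m = (LINT y:B|M. v y)"
    using m0 by (simp add: a_def mean_value_def m_def v_def)
  have "\<bar>v y - a\<bar> \<le> d" if y: "y \<in> B" for y
  proof -
    have "(LINT y:B|M. v y) \<le> (LINT _:B|M. v y + d)"
      using vv[OF _ y] by (intro set_integral_mono int const) (auto simp: abs_le_iff algebra_simps)
    moreover have "(LINT _:B|M. v y - d) \<le> (LINT y:B|M. v y)"
      using vv[OF _ y] by (intro set_integral_mono int const) (auto simp: abs_le_iff algebra_simps)
    ultimately have "a * m \<le> (v y + d) * m" "(v y - d) * m \<le> a * m"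
      unfolding const am .
    then show ?thesis using m0 by (simp add: abs_le_iff)
  qed
  then have "(\<integral>\<^sup>+y\<in>B. e2ennreal \<bar>u y - ereal (mean_value M B u)\<bar> \<partial>M) \<le> (\<integral>\<^sup>+y\<in>B. G \<partial>M)"
    by (intro nn_integral_mono) (auto simp: uv real a_def intro!: ennreal_leI split: split_indicator)
  also have "\<dots> = G * emeasure M B"
    using B by (simp add: nn_integral_cmult_indicator)
  finally show ?thesis
    using m by (intro divide_le_posI_ennreal) (simp_all add: mult.commute)
qed simp

text \<open>For $p > 1$ this is equivalent to the usual $A_p$ bound on the averages of $w$ and $w^{1/(1-p)}$ (take
  $g = w^{1/(1-p)}$), for $p = 1$ to the $A_1$ bound (take indicators for $g$).\<close>

definition muckenhoupt_within :: "real \<Rightarrow> (real \<Rightarrow> ennreal) \<Rightarrow> real set \<Rightarrow> bool" where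
  "muckenhoupt_within p w B0 \<longleftrightarrow>
     (\<exists>C>0. \<forall>x r. 0 < r \<and> ball x r \<subseteq> B0 \<longrightarrow>
        (\<forall>g\<in>borel_measurable lebesgue.
           ennreal_rpow (\<integral>\<^sup>+y\<in>ball x r. g y \<partial>lebesgue) p * (\<integral>\<^sup>+y\<in>ball x r. w y \<partial>lebesgue)
           \<le> ennreal (C * r powr p) * (\<integral>\<^sup>+y\<in>ball x r. ennreal_rpow (g y) p * w y \<partial>lebesgue)))"

lemma muckenhoupt_withinE:
  assumes "muckenhoupt_within p w B0"
  obtains C where "0 < C"
    "\<And>x r g. 0 < r \<Longrightarrow> ball x r \<subseteq> B0 \<Longrightarrow> g \<in> borel_measurable lebesgue \<Longrightarrow>
      ennreal_rpow (\<integral>\<^sup>+y\<in>ball x r. g y \<partial>lebesgue) p * (\<integral>\<^sup>+y\<in>ball x r. w y \<partial>lebesgue)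
      \<le> ennreal (C * r powr p) * (\<integral>\<^sup>+y\<in>ball x r. ennreal_rpow (g y) p * w y \<partial>lebesgue)"
  using assms unfolding muckenhoupt_within_def by blast

lemma muckenhoupt_withinI:
  assumes "0 < C"
    "\<And>x r g. 0 < r \<Longrightarrow> ball x r \<subseteq> B0 \<Longrightarrow> g \<in> borel_measurable lebesgue \<Longrightarrow>
      ennreal_rpow (\<integral>\<^sup>+y\<in>ball x r. g y \<partial>lebesgue) p * (\<integral>\<^sup>+y\<in>ball x r. w y \<partial>lebesgue)
      \<le> ennreal (C * r powr p) * (\<integral>\<^sup>+y\<in>ball x r. ennreal_rpow (g y) p * w y \<partial>lebesgue)"
  shows "muckenhoupt_within p w B0"
  using assms unfolding muckenhoupt_within_def by blast

lemma muckenhoupt_within_subset: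
  "muckenhoupt_within p w B0 \<Longrightarrow> B1 \<subseteq> B0 \<Longrightarrow> muckenhoupt_within p w B1"
  by (elim muckenhoupt_withinE) (rule muckenhoupt_withinI, auto)

section \<open>Measures given by weights, and the passage from the Muckenhoupt condition to
  admissibility\<close>

abbreviation weight_measure :: "(real \<Rightarrow> ennreal) \<Rightarrow> real measure" where
  "weight_measure w \<equiv> completion (density lebesgue w)"

lemma nn_integral_weight_measure:
  assumes "w \<in> borel_measurable lebesgue" "f \<in> borel_measurable lebesgue"
  shows "(\<integral>\<^sup>+y. f y \<partial>weight_measure w) = (\<integral>\<^sup>+y. f y * w y \<partial>lebesgue)"
  using assms by (simp add: nn_integral_completion nn_integral_density mult.commute)

lemma sets_weight_measureI: "A \<in> sets lebesgue \<Longrightarrow> A \<in> sets (weight_measure w)"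
  by (simp add: sets_completionI_sets)

lemma emeasure_weight_measure:
  assumes "w \<in> borel_measurable lebesgue" "A \<in> sets lebesgue"
  shows "emeasure (weight_measure w) A = (\<integral>\<^sup>+y\<in>A. w y \<partial>lebesgue)"
proof -
  have "emeasure (weight_measure w) A = (\<integral>\<^sup>+y. indicator A y \<partial>weight_measure w)"
    using assms by (simp add: sets_weight_measureI)
  also have "\<dots> = (\<integral>\<^sup>+y\<in>A. w y \<partial>lebesgue)"
    using assms by (subst nn_integral_weight_measure) (auto simp: mult.commute)
  finally show ?thesis .
qed

lemma ball_measure_weight_measure_iff:
  assumes "w \<in> borel_measurable lebesgue"
  shows "ball_measure (weight_measure w) \<longleftrightarrow>
    (\<forall>x r. 0 < r \<longrightarrow> 0 < (\<integral>\<^sup>+y\<in>ball x r. w y \<partial>lebesgue) \<and> (\<integral>\<^sup>+y\<in>ball x r. w y \<partial>lebesgue) < \<infinity>)"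
proof -
  have "sets borel \<subseteq> sets (weight_measure w)"
    by (auto intro!: sets_weight_measureI)
  moreover have "complete_measure (weight_measure w)"
    by (rule completion.complete_measure_axioms)
  ultimately show ?thesis
    using assms by (simp add: ball_measure_def emeasure_weight_measure del: emeasure_completion)
qed

lemma poincare_within_if_muckenhoupt_within:
  assumes p: "1 \<le> p" and w: "w \<in> borel_measurable lebesgue"
    and bm: "ball_measure (weight_measure w)" and A: "muckenhoupt_within p w B0"
  shows "poincare_within p (weight_measure w) B0"
proof -
  let ?M = "weight_measure w"
  obtain C where C: "0 < C" and le: "\<And>x r g. 0 < r \<Longrightarrow> ball x r \<subseteq> B0 \<Longrightarrow> g \<in> borel_measurable lebesgue \<Longrightarrow>
      ennreal_rpow (\<integral>\<^sup>+y\<in>ball x r. g y \<partial>lebesgue) p * (\<integral>\<^sup>+y\<in>ball x r. w y \<partial>lebesgue)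
      \<le> ennreal (C * r powr p) * (\<integral>\<^sup>+y\<in>ball x r. ennreal_rpow (g y) p * w y \<partial>lebesgue)"
    using muckenhoupt_withinE[OF A] by blast
  \<comment> \<open>The p-th root undoes the power in
    \<open>ennreal_le_mult_rpow_iff\<close>.\<close>
  define C' where "C' = C powr (1 / p)"
  have C': "0 < C'" "C' powr p = C"
    using C p by (simp_all add: C'_def powr_powr)
  have "(\<integral>\<^sup>+y\<in>ball x r. e2ennreal \<bar>u y - ereal (mean_value ?M (ball x r) u)\<bar> \<partial>?M) / emeasure ?M (ball x r)
      \<le> ennreal (C' * r) * ennreal_rpow ((\<integral>\<^sup>+y\<in>ball x r. ennreal_rpow (g y) p \<partial>?M) / emeasure ?M (ball x r)) (1 / p)"
    if r: "0 < r" and B: "ball x r \<subseteq> B0" and u: "integrable_on_set ?M (ball x r) u"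
      and ug: "upper_gradient (ball x r) g u" for x r u g
  proof -
    let ?B = "ball x r"
    let ?m = "emeasure ?M ?B"
    have m: "0 < ?m" "?m < \<infinity>"
      using bm r by (auto simp: ball_measure_def)
    \<comment> \<open>An upper gradient on the ball is Borel on the ball only; extended by zero it
      is Borel on the line.\<close>
    define h where "h = (\<lambda>y. g y * indicator ?B y)"
    have hb: "h \<in> borel_measurable borel"
      using ug by (simp add: h_def upper_gradient_def borel_measurable_restrict_space_iff_ennreal)
    then have h [measurable]: "h \<in> borel_measurable lebesgue"
      by (simp add: measurable_completion)
    define G where "G = (\<integral>\<^sup>+y. h y \<partial>lborel)"
    have diff: "(if \<bar>u y\<bar> = \<infinity> \<or> \<bar>u y'\<bar> = \<infinity> then \<infinity> else e2ennreal \<bar>u y - u y'\<bar>) \<le> G"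
      if "y \<in> ?B" "y' \<in> ?B" "y \<noteq> y'" for y y'
      using upper_gradient_diff_le[OF ug that] by (simp add: G_def h_def)
    \<comment> \<open>An infinite value at y would make the left side of \<open>diff\<close>
      infinite for any second point of the ball. The centre serves as that point or, if y is the
      centre, a point halfway to the boundary.\<close>
    have fin: "\<bar>u y\<bar> \<noteq> \<infinity>" if G: "G < \<infinity>" and y: "y \<in> ?B" for y
    proof -
      define y' where "y' = (if y = x then x + r / 2 else x)"
      have "y' \<in> ?B" "y \<noteq> y'"
        using r by (auto simp: y'_def dist_real_def)
      from diff[OF y this] G show ?thesis by (auto split: if_splits simp: top_unique)
    qed
    have osc: "e2ennreal \<bar>u y - u y'\<bar> \<le> G" if "y \<in> ?B" "y' \<in> ?B" for y y'
    proof (cases "G < \<infinity>")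
      case True
      have "\<bar>u y\<bar> \<noteq> \<infinity>" "\<bar>u y'\<bar> \<noteq> \<infinity>" using fin True that by auto
      then show ?thesis
        using diff[OF that] by (cases "y = y'") (auto simp flip: zero_ennreal_def)
    next
      case False
      then show ?thesis by (metis infinity_ennreal_def top.not_eq_extremum top_greatest)
    qed
    have "(\<integral>\<^sup>+y\<in>?B. e2ennreal \<bar>u y - ereal (mean_value ?M ?B u)\<bar> \<partial>?M) / ?m \<le> G"
      using m u fin osc by (intro mean_oscillation_le sets_weight_measureI) auto
    also have "G \<le> ennreal (C' * r) * ennreal_rpow ((\<integral>\<^sup>+y. ennreal_rpow (h y) p * w y \<partial>lebesgue) / ?m) (1 / p)"
    proof (subst ennreal_le_mult_rpow_iff)
      have "G = (\<integral>\<^sup>+y\<in>?B. h y \<partial>lebesgue)"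
        unfolding G_def nn_integral_completion
        by (intro nn_integral_cong) (auto simp: h_def split: split_indicator)
      moreover have "(\<integral>\<^sup>+y. ennreal_rpow (h y) p * w y \<partial>lebesgue) = (\<integral>\<^sup>+y\<in>?B. ennreal_rpow (h y) p * w y \<partial>lebesgue)"
        using p by (intro nn_integral_cong) (auto simp: h_def split: split_indicator)
      ultimately show "ennreal_rpow G p * ?m \<le> ennreal ((C' * r) powr p) * (\<integral>\<^sup>+y. ennreal_rpow (h y) p * w y \<partial>lebesgue)"
        using le[OF r B h] w C' r by (simp add: emeasure_weight_measure powr_mult del: emeasure_completion)
    qed (use p C' r m in auto)
    also have "(\<integral>\<^sup>+y. ennreal_rpow (h y) p * w y \<partial>lebesgue) = (\<integral>\<^sup>+y. ennreal_rpow (h y) p \<partial>?M)"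
      using w h by (simp add: nn_integral_weight_measure)
    also have "\<dots> = (\<integral>\<^sup>+y\<in>?B. ennreal_rpow (g y) p \<partial>?M)"
      using p by (intro nn_integral_cong) (auto simp: h_def split: split_indicator)
    finally show ?thesis .
  qed
  note main = this
  show ?thesis
    unfolding poincare_within_def
  proof (rule exI[of _ C'], rule exI[of _ 1], intro conjI allI impI)
    fix x r u g
    assume "0 < r \<and> ball x r \<subseteq> B0 \<and> integrable_on_set ?M (ball x (1 * r)) u \<and> upper_gradient (ball x (1 * r)) g u"
    then show "(\<integral>\<^sup>+y\<in>ball x r. e2ennreal \<bar>u y - ereal (mean_value ?M (ball x r) u)\<bar> \<partial>?M) / emeasure ?M (ball x r)
      \<le> ennreal (C' * r) * ennreal_rpow ((\<integral>\<^sup>+y\<in>ball x (1 * r). ennreal_rpow (g y) p \<partial>?M) / emeasure ?M (ball x (1 * r))) (1 / p)"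
      using main[of r x u g] unfolding mult_1 by blast
  qed (use C' in auto)
qed

text \<open>The radius is halved so that the condition applies to the doubled ball. The indicator of
  B(x,r) has integral 2r, whose p-th power cancels against the radius 2r on the right; so C itself
  is the doubling constant.\<close>

lemma doubling_within_if_muckenhoupt_within:
  assumes p: "1 \<le> p" and w: "w \<in> borel_measurable lebesgue"
    and A: "muckenhoupt_within p w (ball z R)"
  shows "doubling_within (weight_measure w) (ball z (R / 2))"
proof -
  obtain C where C: "0 < C" and le: "\<And>x r g. 0 < r \<Longrightarrow> ball x r \<subseteq> ball z R \<Longrightarrow> g \<in> borel_measurable lebesgue \<Longrightarrow>
      ennreal_rpow (\<integral>\<^sup>+y\<in>ball x r. g y \<partial>lebesgue) p * (\<integral>\<^sup>+y\<in>ball x r. w y \<partial>lebesgue)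
      \<le> ennreal (C * r powr p) * (\<integral>\<^sup>+y\<in>ball x r. ennreal_rpow (g y) p * w y \<partial>lebesgue)"
    using muckenhoupt_withinE[OF A] by blast
  show ?thesis
    unfolding doubling_within_def
  proof (intro exI[of _ C] conjI allI impI)
    fix x r :: real assume "0 < r \<and> ball x r \<subseteq> ball z (R / 2)"
    then have r: "0 < r" and sub: "dist x z + r \<le> R / 2"
      by (auto simp: ball_subset_ball_iff)
    have "ball x (2 * r) \<subseteq> ball z R"
      using r sub zero_le_dist[of x z] unfolding ball_subset_ball_iff by linarith
    from le[OF _ this, of "indicator (ball x r)"] r
    have "ennreal_rpow (\<integral>\<^sup>+y\<in>ball x (2 * r). indicator (ball x r) y \<partial>lebesgue) p * emeasure (weight_measure w) (ball x (2 * r))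
      \<le> ennreal (C * (2 * r) powr p) * (\<integral>\<^sup>+y\<in>ball x (2 * r). ennreal_rpow (indicator (ball x r) y) p * w y \<partial>lebesgue)"
      by (simp add: emeasure_weight_measure w borel_measurable_indicator del: emeasure_completion)
    also have "(\<integral>\<^sup>+y\<in>ball x (2 * r). ennreal_rpow (indicator (ball x r) y) p * w y \<partial>lebesgue) = emeasure (weight_measure w) (ball x r)"
      using p r by (auto simp: emeasure_weight_measure w ennreal_rpow_def split: split_indicator simp del: emeasure_completion intro!: nn_integral_cong)
    also have "(\<integral>\<^sup>+y\<in>ball x (2 * r). indicator (ball x r) y \<partial>lebesgue) = (\<integral>\<^sup>+y. indicator (ball x r) y \<partial>lebesgue)"
      using r by (intro nn_integral_cong) (auto split: split_indicator)
    also have "ennreal_rpow \<dots> p = ennreal ((2 * r) powr p)"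
      using r ennreal_rpow_ennreal[of "2 * r" p] by (simp add: ball_eq_greaterThanLessThan)
    also have "C * (2 * r) powr p = (2 * r) powr p * C" by simp
    finally show "emeasure (weight_measure w) (ball x (2 * r)) \<le> ennreal C * emeasure (weight_measure w) (ball x r)"
      using r C ennreal_rpow_ennreal[of "2 * r" p] by (simp add: ennreal_mult'[of _ C] mult.assoc ennreal_mult_le_mult_iff ennreal_eq_0_iff del: emeasure_completion)
  qed (use C in auto)
qed

section \<open>Necessity of the Muckenhoupt condition\<close>

text \<open>An increment of the primitive is the integral over the interval between the endpoints,
  and a curve joining them must traverse that interval. Finiteness matters because
  \<open>enn2real\<close> sends infinity to 0.\<close>

lemma upper_gradient_primitive:
  fixes h :: "real \<Rightarrow> ennreal"
  assumes h [measurable]: "h \<in> borel_measurable borel" and fin: "(\<integral>\<^sup>+t. h t \<partial>lborel) < \<infinity>"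
  shows "upper_gradient Y h (\<lambda>y. ereal (enn2real (\<integral>\<^sup>+t\<in>{..y}. h t \<partial>lborel)))"
proof -
  define V where "V y = (\<integral>\<^sup>+t\<in>{..y}. h t \<partial>lborel)" for y
  have V_fin: "V y < \<infinity>" for y
  proof -
    have "V y \<le> (\<integral>\<^sup>+t. h t \<partial>lborel)"
      unfolding V_def by (intro nn_integral_mono) (auto split: split_indicator)
    then show ?thesis using fin by order
  qed
  have V_diff: "ennreal (enn2real (V b) - enn2real (V a)) \<le> (\<integral>\<^sup>+t\<in>{a<..<b}. h t \<partial>lborel)"
    if "a \<le> b" for a b
  proof -
    \<comment> \<open>The point b is missing from both sets on the right, which changes nothing up
      to a null set.\<close>
    have "V b \<le> (\<integral>\<^sup>+t. h t * indicator {..a} t + h t * indicator {a<..<b} t \<partial>lborel)"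
      unfolding V_def using AE_lborel_singleton[of b]
      by (intro nn_integral_mono_AE) (auto split: split_indicator)
    also have "\<dots> = V a + (\<integral>\<^sup>+t\<in>{a<..<b}. h t \<partial>lborel)"
      unfolding V_def by (subst nn_integral_add) auto
    finally have "V b - V a \<le> (\<integral>\<^sup>+t\<in>{a<..<b}. h t \<partial>lborel)"
      using V_fin[of a] by (auto simp: ennreal_minus_le_iff)
    moreover have "V b - V a = ennreal (enn2real (V b) - enn2real (V a))"
      using V_fin[of a] V_fin[of b] by (simp add: ennreal_minus[symmetric])
    ultimately show ?thesis by simp
  qed
  have V_mono: "enn2real (V a) \<le> enn2real (V b)" if "a \<le> b" for a b
    using that V_fin[of b] unfolding V_def
    by (intro enn2real_mono nn_integral_mono) (auto split: split_indicator)
  show ?thesis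
    unfolding upper_gradient_def V_def[symmetric]
  proof (intro conjI allI impI)
    show "h \<in> borel_measurable (restrict_space borel Y)"
      by (intro measurable_restrict_space1 h)
    fix l c assume c: "arc_length_curve Y l c"
    let ?a = "min (c 0) (c l)" and ?b = "max (c 0) (c l)"
    have "\<bar>enn2real (V (c 0)) - enn2real (V (c l))\<bar> = enn2real (V ?b) - enn2real (V ?a)"
      using V_mono[of "c 0" "c l"] V_mono[of "c l" "c 0"] by (auto simp: min_def max_def)
    then have "ennreal \<bar>enn2real (V (c 0)) - enn2real (V (c l))\<bar> \<le> (\<integral>\<^sup>+t\<in>{?a<..<?b}. h t \<partial>lborel)"
      using V_diff[of ?a ?b] by simp
    also have "\<dots> \<le> (\<integral>\<^sup>+t\<in>{0..l}. h (c t) \<partial>lborel)"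
    proof (rule nn_integral_le_lipschitz_curve)
      show "0 \<le> l" "continuous_on {0..l} c" using c by (auto simp: arc_length_curve_def)
      show "\<bar>c s - c t\<bar> \<le> t - s" if "0 \<le> s" "s \<le> t" "t \<le> l" for s t
        using arc_length_curve_lipschitz[OF c that] by (simp add: dist_real_def)
    qed measurable
    finally show "(if \<bar>ereal (enn2real (V (c 0)))\<bar> = \<infinity> \<or> \<bar>ereal (enn2real (V (c l)))\<bar> = \<infinity> then \<infinity>
         else e2ennreal \<bar>ereal (enn2real (V (c 0))) - ereal (enn2real (V (c l)))\<bar>)
        \<le> (\<integral>\<^sup>+t\<in>{0..l}. h (c t) \<partial>lborel)"
      by simp
  qed
qed

text \<open>A ball around y needs radius 5r to contain B(x,3r); three doublings reach 8r. Doubling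
  is applied to the radii r, 2r and 4r only, and these balls stay in B(z,R) because |x-z| + r <=
  R/8.\<close>

lemma doubling_triple_le:
  assumes D: "\<And>x r. 0 < r \<Longrightarrow> ball x r \<subseteq> ball z R \<Longrightarrow> emeasure M (ball x (2 * r)) \<le> ennreal D * emeasure M (ball x r)"
    and "0 \<le> D" and r: "0 < r" and sub: "ball x r \<subseteq> ball z (R / 8)" and y: "\<bar>y - x\<bar> = 2 * r"
    and M: "sets borel \<subseteq> sets M"
  shows "emeasure M (ball x (3 * r)) \<le> ennreal (D ^ 3) * emeasure M (ball y r)"
proof -
  have xz: "\<bar>x - z\<bar> + r \<le> R / 8" using r sub by (auto simp: ball_subset_ball_iff dist_real_def)
  have dz: "ball y s \<subseteq> ball z R" if "0 < s" "s \<le> 4 * r" for s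
    using that xz y r unfolding ball_subset_ball_iff dist_real_def by linarith
  have "ball x (3 * r) \<subseteq> ball y (2 * (2 * (2 * r)))"
    using y r by (auto simp: ball_subset_ball_iff dist_real_def)
  moreover have "ball y (2 * (2 * (2 * r))) \<in> sets M"
    using M by auto
  ultimately have "emeasure M (ball x (3 * r)) \<le> emeasure M (ball y (2 * (2 * (2 * r))))"
    by (intro emeasure_mono)
  also have "\<dots> \<le> ennreal D * emeasure M (ball y (2 * (2 * r)))"
    using r by (intro D dz) auto
  also have "\<dots> \<le> ennreal D * (ennreal D * emeasure M (ball y (2 * r)))"
    using r by (intro D dz mult_left_mono) auto
  also have "\<dots> \<le> ennreal D * (ennreal D * (ennreal D * emeasure M (ball y r)))"
    using r by (intro D dz mult_left_mono) auto
  also have "\<dots> = ennreal (D ^ 3) * emeasure M (ball y r)"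
    using \<open>0 \<le> D\<close> by (simp add: power3_eq_cube ennreal_mult mult_ac)
  finally show ?thesis .
qed

text \<open>Truncations have finite integrals over sets of finite measure. This allows primitives to
  be taken in the necessity part and a factor to be cancelled for the dual weight.\<close>

lemma nn_integral_truncate:
  assumes [measurable]: "f \<in> borel_measurable M" "B \<in> sets M"
  shows "(\<integral>\<^sup>+y\<in>B. f y \<partial>M) = (SUP n. \<integral>\<^sup>+y\<in>B. min (f y) (of_nat n) \<partial>M)"
proof -
  have "(SUP n. min x (of_nat n) * i) = x * i" for x i :: ennreal
  proof -
    have "(SUP n. min x (of_nat n)) = min x (SUP n. of_nat n)"
      using inf_SUP[of x of_nat UNIV] by (simp add: inf_min)
    then show ?thesis
      by (simp add: ennreal_SUP_of_nat_eq_top flip: SUP_mult_right_ennreal)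
  qed
  then have "(\<integral>\<^sup>+y\<in>B. f y \<partial>M) = (\<integral>\<^sup>+y. (SUP n. min (f y) (of_nat n) * indicator B y) \<partial>M)"
    by simp
  also have "\<dots> = (SUP n. \<integral>\<^sup>+y\<in>B. min (f y) (of_nat n) \<partial>M)"
    by (intro nn_integral_monotone_convergence_SUP)
       (auto simp: incseq_def le_fun_def intro!: mult_right_mono min.mono)
  finally show ?thesis .
qed

text \<open>The radius shrinks by the factor $8$ so that $3B$ and the balls used to compare $3B$ with its outer
  thirds stay within the ball where the measure is admissible.\<close>

lemma admissible_within_bound:
  assumes p: "1 \<le> p" and bm: "ball_measure M" and adm: "admissible_within p M (ball z R)"
  obtains K where "0 < K"
    "\<And>x r h. 0 < r \<Longrightarrow> ball x r \<subseteq> ball z (R / 8) \<Longrightarrow> h \<in> borel_measurable borel \<Longrightarrow>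
       (\<And>y. y \<notin> ball x r \<Longrightarrow> h y = 0) \<Longrightarrow> (\<integral>\<^sup>+y. h y \<partial>lborel) < \<infinity> \<Longrightarrow>
       (\<integral>\<^sup>+y. h y \<partial>lborel) \<le> ennreal (K * r) * ennreal_rpow ((\<integral>\<^sup>+y. ennreal_rpow (h y) p \<partial>M) / emeasure M (ball x r)) (1 / p)"
proof -
  have borM: "sets borel \<subseteq> sets M"
    and ballM: "\<And>x r. 0 < r \<Longrightarrow> 0 < emeasure M (ball x r)" "\<And>x r. 0 < r \<Longrightarrow> emeasure M (ball x r) < \<infinity>"
    using bm by (auto simp: ball_measure_def)
  have ball_sets [measurable]: "ball x r \<in> sets M" for x r
    using borM by auto
  obtain D where D0: "0 < D"
    and D: "\<And>x r. 0 < r \<Longrightarrow> ball x r \<subseteq> ball z R \<Longrightarrow> emeasure M (ball x (2 * r)) \<le> ennreal D * emeasure M (ball x r)"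
    using adm unfolding admissible_within_def doubling_within_def by blast
  obtain C L where C: "0 < C" and L: "1 \<le> L"
    and P: "\<And>x r u g. 0 < r \<Longrightarrow> ball x r \<subseteq> ball z R \<Longrightarrow>
            integrable_on_set M (ball x (L * r)) u \<Longrightarrow> upper_gradient (ball x (L * r)) g u \<Longrightarrow>
          (\<integral>\<^sup>+y\<in>ball x r. e2ennreal \<bar>u y - ereal (mean_value M (ball x r) u)\<bar> \<partial>M) / emeasure M (ball x r)
          \<le> ennreal (C * r) * ennreal_rpow
               ((\<integral>\<^sup>+y\<in>ball x (L * r). ennreal_rpow (g y) p \<partial>M) / emeasure M (ball x (L * r))) (1 / p)"
    using adm unfolding admissible_within_def poincare_within_def by blast
  show thesis
  proof
    \<comment> \<open>The factor 3 is the radius 3r in the Poincare inequality, and D^3 compares the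
      tripled ball with an outer third.\<close>
    show "0 < 3 * C * D ^ 3" using C D0 by simp
    fix x r and h :: "real \<Rightarrow> ennreal"
    assume r: "0 < r" and sub: "ball x r \<subseteq> ball z (R / 8)" and h [measurable]: "h \<in> borel_measurable borel"
      and h0: "\<And>y. y \<notin> ball x r \<Longrightarrow> h y = 0" and fin: "(\<integral>\<^sup>+y. h y \<partial>lborel) < \<infinity>"
    define U where "U y = enn2real (\<integral>\<^sup>+t\<in>{..y}. h t \<partial>lborel)" for y
    define d where "d = enn2real (\<integral>\<^sup>+y. h y \<partial>lborel)"
    have d: "(\<integral>\<^sup>+y. h y \<partial>lborel) = ennreal d" "0 \<le> d"
      using fin by (simp_all add: d_def)
    have I_le: "(\<integral>\<^sup>+t\<in>{..y}. h t \<partial>lborel) \<le> (\<integral>\<^sup>+t. h t \<partial>lborel)" for y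
      by (intro nn_integral_mono) (auto split: split_indicator)
    have U_bounds: "0 \<le> U y" "U y \<le> d" for y
      using I_le[of y] fin by (auto simp: U_def d_def intro: enn2real_mono)
    have U_mono: "mono U"
    proof (rule monoI)
      fix a b :: real assume "a \<le> b"
      then have "(\<integral>\<^sup>+t\<in>{..a}. h t \<partial>lborel) \<le> (\<integral>\<^sup>+t\<in>{..b}. h t \<partial>lborel)"
        by (intro nn_integral_mono) (auto split: split_indicator)
      moreover have "(\<integral>\<^sup>+t\<in>{..b}. h t \<partial>lborel) < \<infinity>"
        using I_le[of b] fin by (rule le_less_trans)
      ultimately show "U a \<le> U b"
        unfolding U_def by (intro enn2real_mono) auto
    qed
    have U_left: "U y = 0" if "y \<le> x - r" for y
    proof -
      have "(\<integral>\<^sup>+t\<in>{..y}. h t \<partial>lborel) = (\<integral>\<^sup>+t. 0 \<partial>(lborel :: real measure))"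
        using that by (intro nn_integral_cong) (auto simp: dist_real_def intro!: h0 split: split_indicator)
      then show ?thesis by (simp add: U_def)
    qed
    have U_right: "U y = d" if "x + r \<le> y" for y
    proof -
      have "(\<integral>\<^sup>+t\<in>{..y}. h t \<partial>lborel) = (\<integral>\<^sup>+t. h t \<partial>lborel)"
        using that by (intro nn_integral_cong) (auto simp: dist_real_def intro!: h0 split: split_indicator)
      then show ?thesis by (simp add: U_def d_def)
    qed
    have U_borel: "U \<in> borel_measurable borel"
      using U_mono by (rule borel_measurable_mono)
    have UM: "U \<in> borel_measurable M"
      using measurable_mono[of borel borel borel M] U_borel borM bm by (auto simp: ball_measure_def)
    have int: "integrable_on_set M (ball x (L * (3 * r))) (\<lambda>y. ereal (U y))"
      unfolding integrable_on_set_def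
    proof
      show "(\<lambda>y. ereal (U y)) \<in> borel_measurable (restrict_space M (ball x (L * (3 * r))))"
        using UM by (intro measurable_restrict_space1 borel_measurable_ereal)
      have "(\<integral>\<^sup>+y\<in>ball x (L * (3 * r)). e2ennreal \<bar>ereal (U y)\<bar> \<partial>M) \<le> (\<integral>\<^sup>+y\<in>ball x (L * (3 * r)). ennreal d \<partial>M)"
        using U_bounds by (intro nn_integral_mono mult_right_mono) (auto intro: ennreal_leI)
      also have "\<dots> = ennreal d * emeasure M (ball x (L * (3 * r)))"
        by (simp add: nn_integral_cmult_indicator)
      also have "\<dots> < \<infinity>"
        using ballM(2)[of "L * (3 * r)" x] r L by (simp add: ennreal_mult_less_top)
      finally show "(\<integral>\<^sup>+y\<in>ball x (L * (3 * r)). e2ennreal \<bar>ereal (U y)\<bar> \<partial>M) < \<infinity>" .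
    qed
    have ug: "upper_gradient (ball x (L * (3 * r))) h (\<lambda>y. ereal (U y))"
      unfolding U_def by (rule upper_gradient_primitive[OF h fin])
    have "ball x (3 * r) \<subseteq> ball z R"
      using sub r zero_le_dist[of x z] unfolding ball_subset_ball_iff by linarith
    note P3 = P[OF _ this int ug]
    define a where "a = mean_value M (ball x (3 * r)) (\<lambda>y. ereal (U y))"
    define I where "I = (\<integral>\<^sup>+y\<in>ball x (3 * r). ennreal \<bar>U y - a\<bar> \<partial>M)"
    define m3 where "m3 = emeasure M (ball x (3 * r))"
    have m3: "0 < m3" "m3 < \<infinity>" using r ballM by (auto simp: m3_def)
    let ?BL = "ball (x - 2 * r) r" and ?BR = "ball (x + 2 * r) r"
    have tripleL: "m3 \<le> ennreal (D ^ 3) * emeasure M ?BL"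
      unfolding m3_def using D0 r sub borM by (intro doubling_triple_le[OF D]) auto
    have tripleR: "m3 \<le> ennreal (D ^ 3) * emeasure M ?BR"
      unfolding m3_def using D0 r sub borM by (intro doubling_triple_le[OF D]) auto
    \<comment> \<open>The primitive is 0 on the left third and d on the right third of the tripled
      ball. Its mean a cannot be close to both, as d <= |a| + |d - a|.\<close>
    have "ennreal \<bar>a\<bar> * emeasure M ?BL + ennreal \<bar>d - a\<bar> * emeasure M ?BR
        = (\<integral>\<^sup>+y. ennreal \<bar>a\<bar> * indicator ?BL y + ennreal \<bar>d - a\<bar> * indicator ?BR y \<partial>M)"
      by (subst nn_integral_add) (auto simp: nn_integral_cmult_indicator)
    also have "\<dots> \<le> I"
      unfolding I_def
    proof (intro nn_integral_mono)
      fix y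
      show "ennreal \<bar>a\<bar> * indicator ?BL y + ennreal \<bar>d - a\<bar> * indicator ?BR y
          \<le> ennreal \<bar>U y - a\<bar> * indicator (ball x (3 * r)) y"
        using U_left[of y] U_right[of y] r
        by (auto simp: indicator_def dist_real_def abs_if split: if_splits)
    qed
    finally have I_ge: "ennreal \<bar>a\<bar> * emeasure M ?BL + ennreal \<bar>d - a\<bar> * emeasure M ?BR \<le> I" .
    have "ennreal d * m3 \<le> (ennreal \<bar>a\<bar> + ennreal \<bar>d - a\<bar>) * m3"
      by (intro mult_right_mono) (auto simp flip: ennreal_plus intro!: ennreal_leI)
    also have "\<dots> \<le> ennreal \<bar>a\<bar> * (ennreal (D ^ 3) * emeasure M ?BL) + ennreal \<bar>d - a\<bar> * (ennreal (D ^ 3) * emeasure M ?BR)"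
      unfolding distrib_right by (intro add_mono mult_left_mono tripleL tripleR) auto
    also have "\<dots> = ennreal (D ^ 3) * (ennreal \<bar>a\<bar> * emeasure M ?BL + ennreal \<bar>d - a\<bar> * emeasure M ?BR)"
      by (simp add: distrib_left mult_ac)
    also have "\<dots> \<le> ennreal (D ^ 3) * I"
      by (intro mult_left_mono I_ge) auto
    finally have "ennreal d \<le> ennreal (D ^ 3) * I / m3"
      using m3 divide_less_ennreal[of m3 "ennreal (D ^ 3) * I" "ennreal d"] by (auto simp: not_less[symmetric])
    also have "\<dots> = ennreal (D ^ 3) * (I / m3)"
      by (simp add: ennreal_times_divide)
    also have "\<dots> \<le> ennreal (D ^ 3) * (ennreal (C * (3 * r)) * ennreal_rpow
               ((\<integral>\<^sup>+y\<in>ball x (L * (3 * r)). ennreal_rpow (h y) p \<partial>M) / emeasure M (ball x (L * (3 * r)))) (1 / p))"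
      using P3 r by (intro mult_left_mono) (simp_all add: I_def m3_def a_def)
    \<comment> \<open>The dilation constant disappears here: the numerator is enlarged to the whole
      line, where h lives on B(x,r) anyway, and the denominator is reduced to the measure of
      B(x,r).\<close>
    also have "\<dots> \<le> ennreal (D ^ 3) * (ennreal (C * (3 * r)) * ennreal_rpow
               ((\<integral>\<^sup>+y. ennreal_rpow (h y) p \<partial>M) / emeasure M (ball x r)) (1 / p))"
    proof (intro mult_left_mono ennreal_rpow_mono)
      have "(\<integral>\<^sup>+y\<in>ball x (L * (3 * r)). ennreal_rpow (h y) p \<partial>M) \<le> (\<integral>\<^sup>+y. ennreal_rpow (h y) p \<partial>M)"
        by (intro nn_integral_mono) (auto split: split_indicator)
      moreover have "emeasure M (ball x r) \<le> emeasure M (ball x (L * (3 * r)))"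
        using r L mult_right_mono[of 1 L "3 * r"] by (intro emeasure_mono ball_sets subset_ball) auto
      ultimately show "(\<integral>\<^sup>+y\<in>ball x (L * (3 * r)). ennreal_rpow (h y) p \<partial>M) / emeasure M (ball x (L * (3 * r)))
          \<le> (\<integral>\<^sup>+y. ennreal_rpow (h y) p \<partial>M) / emeasure M (ball x r)"
        unfolding divide_ennreal_def by (intro mult_mono inverse_antimono_ennreal) auto
    qed (use p in auto)
    also have "\<dots> = ennreal (3 * C * D ^ 3 * r) * ennreal_rpow
               ((\<integral>\<^sup>+y. ennreal_rpow (h y) p \<partial>M) / emeasure M (ball x r)) (1 / p)"
    proof -
      have "ennreal (D ^ 3) * ennreal (C * (3 * r)) = ennreal (3 * C * D ^ 3 * r)"
        using C D0 r by (subst ennreal_mult[symmetric]) (auto simp: mult_ac)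
      then show ?thesis by (simp only: mult.assoc[symmetric])
    qed
    finally show "(\<integral>\<^sup>+y. h y \<partial>lborel) \<le> ennreal (3 * C * D ^ 3 * r) * ennreal_rpow
               ((\<integral>\<^sup>+y. ennreal_rpow (h y) p \<partial>M) / emeasure M (ball x r)) (1 / p)"
      unfolding d(1) .
  qed
qed

text \<open>The condition tests Lebesgue measurable g with possibly infinite integral, while the
  preceding bound covers Borel functions with finite integral. A Borel representative of g and
  truncation bridge the gap.\<close>

lemma muckenhoupt_within_if_admissible_within:
  assumes p: "1 \<le> p" and w: "w \<in> borel_measurable lebesgue"
    and bm: "ball_measure (weight_measure w)" and adm: "admissible_within p (weight_measure w) (ball z R)"
  shows "muckenhoupt_within p w (ball z (R / 8))"
proof -
  let ?M = "weight_measure w"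
  obtain K where K: "0 < K" and bound: "\<And>x r h. 0 < r \<Longrightarrow> ball x r \<subseteq> ball z (R / 8) \<Longrightarrow> h \<in> borel_measurable borel \<Longrightarrow>
       (\<And>y. y \<notin> ball x r \<Longrightarrow> h y = 0) \<Longrightarrow> (\<integral>\<^sup>+y. h y \<partial>lborel) < \<infinity> \<Longrightarrow>
       (\<integral>\<^sup>+y. h y \<partial>lborel) \<le> ennreal (K * r) * ennreal_rpow ((\<integral>\<^sup>+y. ennreal_rpow (h y) p \<partial>?M) / emeasure ?M (ball x r)) (1 / p)"
    using admissible_within_bound[OF p bm adm] by metis
  have "ennreal_rpow (\<integral>\<^sup>+y\<in>ball x r. g y \<partial>lebesgue) p * (\<integral>\<^sup>+y\<in>ball x r. w y \<partial>lebesgue)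
      \<le> ennreal (K powr p * r powr p) * (\<integral>\<^sup>+y\<in>ball x r. ennreal_rpow (g y) p * w y \<partial>lebesgue)"
    if r: "0 < r" and sub: "ball x r \<subseteq> ball z (R / 8)" and g: "g \<in> borel_measurable lebesgue" for x r g
  proof -
    let ?B = "ball x r"
    let ?m = "emeasure ?M ?B"
    let ?T = "\<integral>\<^sup>+y\<in>?B. ennreal_rpow (g y) p * w y \<partial>lebesgue"
    have m: "0 < ?m" "?m < \<infinity>"
      using bm r by (auto simp: ball_measure_def)
    obtain g' where g' [measurable]: "g' \<in> borel_measurable borel" and ae: "AE y in lebesgue. g y = g' y"
      using completion_ex_borel_measurable[OF g] by (auto simp: AE_completion_iff)
    have g'_leb: "g' \<in> borel_measurable lebesgue" by (simp add: measurable_completion)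
    have trunc: "(\<integral>\<^sup>+y\<in>?B. min (g' y) (of_nat n) \<partial>lebesgue) \<le> ennreal (K * r) * ennreal_rpow (?T / ?m) (1 / p)" for n
    proof -
      define h where "h y = min (g' y) (of_nat n) * indicator ?B y" for y
      have h [measurable]: "h \<in> borel_measurable borel"
        unfolding h_def by (intro borel_measurable_times_ennreal borel_measurable_indicator borel_measurable_min) auto
      then have h_leb: "h \<in> borel_measurable lebesgue" by (simp add: measurable_completion)
      have "(\<integral>\<^sup>+y. h y \<partial>lborel) \<le> (\<integral>\<^sup>+y. of_nat n * indicator ?B y \<partial>lborel)"
        by (intro nn_integral_mono) (auto simp: h_def split: split_indicator)
      also have "\<dots> < \<infinity>"
        using r by (simp add: nn_integral_cmult_indicator ball_eq_greaterThanLessThan ennreal_mult_less_top of_nat_less_top)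
      finally have h_fin: "(\<integral>\<^sup>+y. h y \<partial>lborel) < \<infinity>" .
      have "AE y in lebesgue. ennreal_rpow (h y) p * w y \<le> ennreal_rpow (g y) p * w y * indicator ?B y"
        using ae
      proof eventually_elim
        case (elim y)
        then show ?case
          using p by (cases "y \<in> ?B") (auto simp: h_def intro!: mult_right_mono ennreal_rpow_mono)
      qed
      then have T: "(\<integral>\<^sup>+y. ennreal_rpow (h y) p * w y \<partial>lebesgue) \<le> ?T"
        by (rule nn_integral_mono_AE)
      have "(\<integral>\<^sup>+y\<in>?B. min (g' y) (of_nat n) \<partial>lebesgue) = (\<integral>\<^sup>+y. h y \<partial>lborel)"
        by (simp add: h_def nn_integral_completion)
      also have "\<dots> \<le> ennreal (K * r) * ennreal_rpow ((\<integral>\<^sup>+y. ennreal_rpow (h y) p \<partial>?M) / ?m) (1 / p)"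
        using h_fin by (intro bound[OF r sub h]) (simp_all add: h_def)
      also have "(\<integral>\<^sup>+y. ennreal_rpow (h y) p \<partial>?M) = (\<integral>\<^sup>+y. ennreal_rpow (h y) p * w y \<partial>lebesgue)"
        using w h_leb by (simp add: nn_integral_weight_measure)
      also have "ennreal (K * r) * ennreal_rpow (\<dots> / ?m) (1 / p) \<le> ennreal (K * r) * ennreal_rpow (?T / ?m) (1 / p)"
        using p by (intro mult_left_mono ennreal_rpow_mono divide_right_mono_ennreal T) auto
      finally show ?thesis .
    qed
    have "(\<integral>\<^sup>+y\<in>?B. g y \<partial>lebesgue) = (\<integral>\<^sup>+y\<in>?B. g' y \<partial>lebesgue)"
      using ae by (intro nn_integral_cong_AE) auto
    also have "\<dots> \<le> ennreal (K * r) * ennreal_rpow (?T / ?m) (1 / p)"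
      unfolding nn_integral_truncate[OF g'_leb, of ?B, simplified] by (intro SUP_least trunc)
    \<comment> \<open>The inequality obtained so far is itself the left side of this equivalence;
      the chain ends with its product form.\<close>
    also have "(\<dots> \<ge> (\<integral>\<^sup>+y\<in>?B. g y \<partial>lebesgue)) \<longleftrightarrow>
        ennreal_rpow (\<integral>\<^sup>+y\<in>?B. g y \<partial>lebesgue) p * ?m \<le> ennreal ((K * r) powr p) * ?T"
      using p K r m by (intro ennreal_le_mult_rpow_iff) auto
    finally show ?thesis
      using K r w by (simp add: emeasure_weight_measure powr_mult del: emeasure_completion)
  qed
  then show ?thesis
    using K by (intro muckenhoupt_withinI[of "K powr p"]) simp_all
qed

section \<open>Maximum and minimum of weights\<close>

lemma borel_measurable_times_indicator_ball [measurable (raw), simp]: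
  fixes f :: "real \<Rightarrow> ennreal"
  shows "f \<in> borel_measurable lebesgue \<Longrightarrow> (\<lambda>y. f y * indicator (ball x r) y) \<in> borel_measurable lebesgue"
  by (intro borel_measurable_times_ennreal borel_measurable_indicator) auto

text \<open>Each implication shrinks the radius by a fixed factor, which is harmless locally. From
  here on only the Muckenhoupt condition and the integrals over balls are handled.\<close>

lemma locally_admissible_weight_iff_muckenhoupt:
  assumes p: "1 \<le> p"
  shows "locally_admissible_weight p w \<longleftrightarrow>
    w \<in> borel_measurable lebesgue \<and>
    (\<forall>x r. 0 < r \<longrightarrow> 0 < (\<integral>\<^sup>+y\<in>ball x r. w y \<partial>lebesgue) \<and> (\<integral>\<^sup>+y\<in>ball x r. w y \<partial>lebesgue) < \<infinity>) \<and>
    (\<forall>x. \<exists>R>0. muckenhoupt_within p w (ball x R))"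
proof (cases "w \<in> borel_measurable lebesgue \<and> ball_measure (weight_measure w)")
  case True
  then have w: "w \<in> borel_measurable lebesgue" and bm: "ball_measure (weight_measure w)" by auto
  have "(\<exists>R>0. admissible_within p (weight_measure w) (ball x R)) \<longleftrightarrow> (\<exists>R>0. muckenhoupt_within p w (ball x R))" for x
  proof
    assume "\<exists>R>0. admissible_within p (weight_measure w) (ball x R)"
    then obtain R where "0 < R" "admissible_within p (weight_measure w) (ball x R)" by blast
    then show "\<exists>R>0. muckenhoupt_within p w (ball x R)"
      using muckenhoupt_within_if_admissible_within[OF p w bm] by (intro exI[of _ "R / 8"]) simp
  next
    assume "\<exists>R>0. muckenhoupt_within p w (ball x R)"
    then obtain R where R: "0 < R" "muckenhoupt_within p w (ball x R)" by blast
    moreover from R have "muckenhoupt_within p w (ball x (R / 2))"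
      by (intro muckenhoupt_within_subset[OF R(2)] subset_ball) simp
    ultimately show "\<exists>R>0. admissible_within p (weight_measure w) (ball x R)"
      unfolding admissible_within_def
      using doubling_within_if_muckenhoupt_within[OF p w] poincare_within_if_muckenhoupt_within[OF p w bm]
      by (intro exI[of _ "R / 2"]) simp
  qed
  then show ?thesis
    using w bm ball_measure_weight_measure_iff[OF w]
    unfolding locally_admissible_weight_def locally_admissible_def by simp
next
  case False
  then show ?thesis
    using ball_measure_weight_measure_iff[of w]
    unfolding locally_admissible_weight_def locally_admissible_def by blast
qed

text \<open>Test the condition with the indicator of the zero set of w: the right side vanishes, so
  the zero set is null in the ball.\<close>

lemma AE_pos_if_muckenhoupt_within:
  assumes p: "1 \<le> p" and w: "w \<in> borel_measurable lebesgue"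
    and A: "muckenhoupt_within p w (ball x r)" and r: "0 < r"
    and m: "0 < (\<integral>\<^sup>+y\<in>ball x r. w y \<partial>lebesgue)"
  shows "AE y in lebesgue. y \<in> ball x r \<longrightarrow> 0 < w y"
proof -
  let ?E = "{y. w y = 0}"
  have E: "?E \<in> sets lebesgue"
    using measurable_sets[OF w, of "{0}"] by (simp add: vimage_def)
  then have ind: "indicator ?E \<in> borel_measurable lebesgue" by simp
  obtain C where le: "ennreal_rpow (\<integral>\<^sup>+y\<in>ball x r. indicator ?E y \<partial>lebesgue) p * (\<integral>\<^sup>+y\<in>ball x r. w y \<partial>lebesgue)
      \<le> ennreal (C * r powr p) * (\<integral>\<^sup>+y\<in>ball x r. ennreal_rpow (indicator ?E y) p * w y \<partial>lebesgue)"
    using A ind r by (elim muckenhoupt_withinE) blast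
  also have "(\<integral>\<^sup>+y\<in>ball x r. ennreal_rpow (indicator ?E y) p * w y \<partial>lebesgue) = (\<integral>\<^sup>+y. 0 \<partial>(lebesgue :: real measure))"
    using p by (intro nn_integral_cong) (auto split: split_indicator)
  finally have "(\<integral>\<^sup>+y\<in>ball x r. indicator ?E y \<partial>lebesgue) = 0"
    using p m by (auto simp: ennreal_rpow_eq_0_iff)
  then have "AE y in lebesgue. indicator ?E y * indicator (ball x r) y = (0::ennreal)"
    using nn_integral_0_iff_AE[of "\<lambda>y. indicator ?E y * indicator (ball x r) y" lebesgue] E by simp
  then show ?thesis
    by eventually_elim (auto simp: zero_less_iff_neq_zero split: split_indicator_asm)
qed

lemma set_nn_integral_ball_pos:
  fixes x :: real
  assumes f: "f \<in> borel_measurable lebesgue" and r: "0 < r" and ae: "AE y in lebesgue. y \<in> ball x r \<longrightarrow> 0 < f y"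
  shows "0 < (\<integral>\<^sup>+y\<in>ball x r. f y \<partial>lebesgue)"
proof (rule ccontr)
  assume "\<not> 0 < (\<integral>\<^sup>+y\<in>ball x r. f y \<partial>lebesgue)"
  then have "AE y in lebesgue. f y * indicator (ball x r) y = 0"
    using nn_integral_0_iff_AE[of "\<lambda>y. f y * indicator (ball x r) y" lebesgue] f
    by (simp add: zero_less_iff_neq_zero)
  with ae have "AE y in lebesgue. y \<notin> ball x r"
    by eventually_elim (auto split: split_indicator_asm)
  then have "emeasure lebesgue (ball x r) = 0"
    using emeasure_eq_0_AE[of "\<lambda>y. y \<in> ball x r" lebesgue] by (simp del: mem_ball)
  then show False using r by (simp add: ball_eq_greaterThanLessThan)
qed

lemma muckenhoupt_within_max:
  assumes w: "w1 \<in> borel_measurable lebesgue" "w2 \<in> borel_measurable lebesgue"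
    and A1: "muckenhoupt_within p w1 B0" and A2: "muckenhoupt_within p w2 B0"
  shows "muckenhoupt_within p (\<lambda>y. max (w1 y) (w2 y)) B0"
proof -
  note [measurable] = w
  obtain C1 where C1: "0 < C1" and le1: "\<And>x r g. 0 < r \<Longrightarrow> ball x r \<subseteq> B0 \<Longrightarrow> g \<in> borel_measurable lebesgue \<Longrightarrow>
      ennreal_rpow (\<integral>\<^sup>+y\<in>ball x r. g y \<partial>lebesgue) p * (\<integral>\<^sup>+y\<in>ball x r. w1 y \<partial>lebesgue)
      \<le> ennreal (C1 * r powr p) * (\<integral>\<^sup>+y\<in>ball x r. ennreal_rpow (g y) p * w1 y \<partial>lebesgue)"
    using muckenhoupt_withinE[OF A1] by blast
  obtain C2 where C2: "0 < C2" and le2: "\<And>x r g. 0 < r \<Longrightarrow> ball x r \<subseteq> B0 \<Longrightarrow> g \<in> borel_measurable lebesgue \<Longrightarrow>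
      ennreal_rpow (\<integral>\<^sup>+y\<in>ball x r. g y \<partial>lebesgue) p * (\<integral>\<^sup>+y\<in>ball x r. w2 y \<partial>lebesgue)
      \<le> ennreal (C2 * r powr p) * (\<integral>\<^sup>+y\<in>ball x r. ennreal_rpow (g y) p * w2 y \<partial>lebesgue)"
    using muckenhoupt_withinE[OF A2] by blast
  show ?thesis
  proof (rule muckenhoupt_withinI)
    show "0 < C1 + C2" using C1 C2 by simp
    fix x r and g :: "real \<Rightarrow> ennreal"
    assume r: "0 < r" and sub: "ball x r \<subseteq> B0" and g: "g \<in> borel_measurable lebesgue"
    let ?B = "ball x r"
    let ?G = "ennreal_rpow (\<integral>\<^sup>+y\<in>?B. g y \<partial>lebesgue) p"
    let ?K = "\<integral>\<^sup>+y\<in>?B. ennreal_rpow (g y) p * max (w1 y) (w2 y) \<partial>lebesgue"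
    have "(\<integral>\<^sup>+y\<in>?B. max (w1 y) (w2 y) \<partial>lebesgue) \<le> (\<integral>\<^sup>+y. w1 y * indicator ?B y + w2 y * indicator ?B y \<partial>lebesgue)"
      by (intro nn_integral_mono) (auto simp: max_def split: split_indicator)
    also have "\<dots> = (\<integral>\<^sup>+y\<in>?B. w1 y \<partial>lebesgue) + (\<integral>\<^sup>+y\<in>?B. w2 y \<partial>lebesgue)"
      by (subst nn_integral_add) auto
    finally have "?G * (\<integral>\<^sup>+y\<in>?B. max (w1 y) (w2 y) \<partial>lebesgue)
        \<le> ?G * (\<integral>\<^sup>+y\<in>?B. w1 y \<partial>lebesgue) + ?G * (\<integral>\<^sup>+y\<in>?B. w2 y \<partial>lebesgue)"
      unfolding distrib_left[symmetric] by (rule mult_left_mono) simp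
    also have "\<dots> \<le> ennreal (C1 * r powr p) * (\<integral>\<^sup>+y\<in>?B. ennreal_rpow (g y) p * w1 y \<partial>lebesgue)
         + ennreal (C2 * r powr p) * (\<integral>\<^sup>+y\<in>?B. ennreal_rpow (g y) p * w2 y \<partial>lebesgue)"
      by (intro add_mono le1 le2 r sub g)
    also have "\<dots> \<le> ennreal (C1 * r powr p) * ?K + ennreal (C2 * r powr p) * ?K"
      by (intro add_mono mult_left_mono nn_integral_mono mult_right_mono) auto
    also have "\<dots> = ennreal ((C1 + C2) * r powr p) * ?K"
      using C1 C2 by (simp add: distrib_right)
    finally show "?G * (\<integral>\<^sup>+y\<in>?B. max (w1 y) (w2 y) \<partial>lebesgue) \<le> ennreal ((C1 + C2) * r powr p) * ?K" .
  qed
qed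

lemma muckenhoupt_within_min:
  assumes p: "1 \<le> p" and w: "w1 \<in> borel_measurable lebesgue" "w2 \<in> borel_measurable lebesgue"
    and A1: "muckenhoupt_within p w1 B0" and A2: "muckenhoupt_within p w2 B0"
  shows "muckenhoupt_within p (\<lambda>y. min (w1 y) (w2 y)) B0"
proof -
  note [measurable] = w
  obtain C1 where C1: "0 < C1" and le1: "\<And>x r g. 0 < r \<Longrightarrow> ball x r \<subseteq> B0 \<Longrightarrow> g \<in> borel_measurable lebesgue \<Longrightarrow>
      ennreal_rpow (\<integral>\<^sup>+y\<in>ball x r. g y \<partial>lebesgue) p * (\<integral>\<^sup>+y\<in>ball x r. w1 y \<partial>lebesgue)
      \<le> ennreal (C1 * r powr p) * (\<integral>\<^sup>+y\<in>ball x r. ennreal_rpow (g y) p * w1 y \<partial>lebesgue)"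
    using muckenhoupt_withinE[OF A1] by blast
  obtain C2 where C2: "0 < C2" and le2: "\<And>x r g. 0 < r \<Longrightarrow> ball x r \<subseteq> B0 \<Longrightarrow> g \<in> borel_measurable lebesgue \<Longrightarrow>
      ennreal_rpow (\<integral>\<^sup>+y\<in>ball x r. g y \<partial>lebesgue) p * (\<integral>\<^sup>+y\<in>ball x r. w2 y \<partial>lebesgue)
      \<le> ennreal (C2 * r powr p) * (\<integral>\<^sup>+y\<in>ball x r. ennreal_rpow (g y) p * w2 y \<partial>lebesgue)"
    using muckenhoupt_withinE[OF A2] by blast
  show ?thesis
  proof (rule muckenhoupt_withinI)
    show "0 < 2 powr p * (C1 + C2)" using C1 C2 by simp
    fix x r and g :: "real \<Rightarrow> ennreal"
    assume r: "0 < r" and sub: "ball x r \<subseteq> B0" and g [measurable]: "g \<in> borel_measurable lebesgue"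
    let ?B = "ball x r"
    let ?m = "\<integral>\<^sup>+y\<in>?B. min (w1 y) (w2 y) \<partial>lebesgue"
    let ?K = "\<integral>\<^sup>+y\<in>?B. ennreal_rpow (g y) p * min (w1 y) (w2 y) \<partial>lebesgue"
    \<comment> \<open>Where g1 is nonzero the minimum is w1, so on the right w1 may be replaced by
      the minimum; on the left the minimum is at most w1 everywhere. The same holds for g2 and
      w2.\<close>
    define g1 where "g1 y = (if w1 y \<le> w2 y then g y else 0)" for y
    define g2 where "g2 y = (if w1 y \<le> w2 y then 0 else g y)" for y
    have [measurable]: "g1 \<in> borel_measurable lebesgue" "g2 \<in> borel_measurable lebesgue"
      unfolding g1_def g2_def by measurable
    let ?G1 = "\<integral>\<^sup>+y\<in>?B. g1 y \<partial>lebesgue" and ?G2 = "\<integral>\<^sup>+y\<in>?B. g2 y \<partial>lebesgue"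
    have "ennreal_rpow ?G1 p * ?m \<le> ennreal_rpow ?G1 p * (\<integral>\<^sup>+y\<in>?B. w1 y \<partial>lebesgue)"
      by (intro mult_left_mono nn_integral_mono mult_right_mono) auto
    also have "\<dots> \<le> ennreal (C1 * r powr p) * (\<integral>\<^sup>+y\<in>?B. ennreal_rpow (g1 y) p * w1 y \<partial>lebesgue)"
      by (intro le1 r sub) measurable
    also have "\<dots> \<le> ennreal (C1 * r powr p) * ?K"
      using p by (intro mult_left_mono nn_integral_mono mult_right_mono) (auto simp: g1_def min_def)
    finally have G1: "ennreal_rpow ?G1 p * ?m \<le> ennreal (C1 * r powr p) * ?K" .
    have "ennreal_rpow ?G2 p * ?m \<le> ennreal_rpow ?G2 p * (\<integral>\<^sup>+y\<in>?B. w2 y \<partial>lebesgue)"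
      by (intro mult_left_mono nn_integral_mono mult_right_mono) auto
    also have "\<dots> \<le> ennreal (C2 * r powr p) * (\<integral>\<^sup>+y\<in>?B. ennreal_rpow (g2 y) p * w2 y \<partial>lebesgue)"
      by (intro le2 r sub) measurable
    also have "\<dots> \<le> ennreal (C2 * r powr p) * ?K"
      using p by (intro mult_left_mono nn_integral_mono mult_right_mono) (auto simp: g2_def min_def)
    finally have G2: "ennreal_rpow ?G2 p * ?m \<le> ennreal (C2 * r powr p) * ?K" .
    have "(\<integral>\<^sup>+y\<in>?B. g y \<partial>lebesgue) = (\<integral>\<^sup>+y. g1 y * indicator ?B y + g2 y * indicator ?B y \<partial>lebesgue)"
      by (intro nn_integral_cong) (auto simp: g1_def g2_def)
    also have "\<dots> = ?G1 + ?G2"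
      by (subst nn_integral_add) auto
    finally have "ennreal_rpow (\<integral>\<^sup>+y\<in>?B. g y \<partial>lebesgue) p * ?m
        \<le> ennreal (2 powr p) * (ennreal_rpow ?G1 p + ennreal_rpow ?G2 p) * ?m"
      using ennreal_rpow_add_le[of p ?G1 ?G2] p by (intro mult_right_mono) auto
    also have "\<dots> = ennreal (2 powr p) * (ennreal_rpow ?G1 p * ?m + ennreal_rpow ?G2 p * ?m)"
      by (simp only: distrib_right mult.assoc)
    also have "\<dots> \<le> ennreal (2 powr p) * (ennreal (C1 * r powr p) * ?K + ennreal (C2 * r powr p) * ?K)"
      by (intro mult_left_mono add_mono G1 G2) auto
    also have "\<dots> = ennreal (2 powr p) * (ennreal ((C1 + C2) * r powr p) * ?K)"
      using C1 C2 by (simp add: distrib_right)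
    also have "\<dots> = ennreal (2 powr p * (C1 + C2) * r powr p) * ?K"
      using C1 C2 by (simp add: ennreal_mult mult.assoc)
    finally show "ennreal_rpow (\<integral>\<^sup>+y\<in>?B. g y \<partial>lebesgue) p * ?m \<le> ennreal (2 powr p * (C1 + C2) * r powr p) * ?K" .
  qed
qed

section \<open>The dual weight\<close>

text \<open>Only an inequality: for x equal to 0 or infinity the product is 0 times infinity, which
  is 0.\<close>

lemma ennreal_rpow_mult_inverse_le: "ennreal_rpow x (- 1) * x \<le> 1"
proof (cases x rule: ennreal_zero_top_cases)
  case (3 r)
  then show ?thesis by (simp add: ennreal_rpow_ennreal powr_minus flip: ennreal_mult)
qed (simp_all add: ennreal_rpow_def)

text \<open>Raising the hypothesis to the power p-1 bounds that power of g by 1/w, so in g^p w all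
  but one factor g is absorbed.\<close>

lemma dual_weight_truncation_le:
  assumes p: "1 < p" and g: "g \<le> ennreal_rpow w (1 / (1 - p))"
  shows "ennreal_rpow g p * w \<le> g"
proof -
  have "ennreal_rpow g (p - 1) \<le> ennreal_rpow (ennreal_rpow w (1 / (1 - p))) (p - 1)"
    using p by (intro ennreal_rpow_mono g) simp
  also have "\<dots> = ennreal_rpow w (1 / (1 - p) * (p - 1))"
    using p by (intro ennreal_rpow_rpow) auto
  also have "1 / (1 - p) * (p - 1) = - 1"
    using p by (simp add: field_simps)
  finally have *: "ennreal_rpow g (p - 1) * w \<le> 1"
    using ennreal_rpow_mult_inverse_le[of w] by (meson mult_right_mono order_trans zero_le)
  have "ennreal_rpow g p * w = g * (ennreal_rpow g (p - 1) * w)"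
    using ennreal_rpow_add[of 1 "p - 1" g] p by (simp add: mult.assoc)
  also have "\<dots> \<le> g * 1"
    by (intro mult_left_mono *) simp
  finally show ?thesis by simp
qed

text \<open>If the first term on the right is smaller than $g$, then $g/(tw) > 1$ and the second term is
  $g \cdot (g/(tw))^s$.\<close>

lemma weight_dual_weight_split:
  assumes s: "0 < s" and t: "0 < t"
  shows "g \<le> ennreal t * w + ennreal (t powr - s) * (ennreal_rpow g (1 + s) * ennreal_rpow w (- s))"
proof (cases w rule: ennreal_zero_top_cases; cases g rule: ennreal_zero_top_cases)
  fix a b :: real
  assume w: "w = ennreal a" "0 < a" and g: "g = ennreal b" "0 < b"
  have "b \<le> t * a + t powr - s * (b powr (1 + s) * a powr - s)"
  proof (cases "b \<le> t * a")
    case False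
    have "b = b * (b powr s * b powr - s)"
      using g by (simp flip: powr_add)
    also have "\<dots> \<le> b * (b powr s * (t * a) powr - s)"
      using False g w s t by (intro mult_left_mono powr_mono2') auto
    also have "\<dots> = t powr - s * (b powr (1 + s) * a powr - s)"
      using g w t by (simp add: powr_add powr_mult)
    finally show ?thesis using t w by (smt (verit) mult_pos_pos)
  qed (simp add: add_increasing2)
  then have "ennreal b \<le> ennreal (t * a + t powr - s * (b powr (1 + s) * a powr - s))"
    by (rule ennreal_leI)
  then show ?thesis
    using w g t by (simp add: ennreal_rpow_ennreal ennreal_mult)
qed (use s t in \<open>auto simp: ennreal_rpow_def ennreal_mult_top ennreal_top_mult ennreal_eq_0_iff\<close>)

text \<open>With g the truncated dual weight and G its integral over B, the hypothesis reads G^p m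
  <= A G. As G is finite, one factor cancels, and the bound obtained does not depend on the
  truncation level.\<close>

lemma dual_weight_ball_le:
  assumes p: "1 < p" and w: "w \<in> borel_measurable lebesgue"
    and B: "B \<in> sets lebesgue" "emeasure lebesgue B < \<infinity>"
    and m: "0 < (\<integral>\<^sup>+y\<in>B. w y \<partial>lebesgue)" "(\<integral>\<^sup>+y\<in>B. w y \<partial>lebesgue) < \<infinity>"
    and le: "\<And>g. g \<in> borel_measurable lebesgue \<Longrightarrow>
      ennreal_rpow (\<integral>\<^sup>+y\<in>B. g y \<partial>lebesgue) p * (\<integral>\<^sup>+y\<in>B. w y \<partial>lebesgue)
      \<le> A * (\<integral>\<^sup>+y\<in>B. ennreal_rpow (g y) p * w y \<partial>lebesgue)"
  shows "ennreal_rpow (\<integral>\<^sup>+y\<in>B. ennreal_rpow (w y) (1 / (1 - p)) \<partial>lebesgue) (p - 1)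
           * (\<integral>\<^sup>+y\<in>B. w y \<partial>lebesgue) \<le> A"
proof -
  note [measurable] = w B(1)
  define \<sigma> where "\<sigma> y = ennreal_rpow (w y) (1 / (1 - p))" for y
  have \<sigma> [measurable]: "\<sigma> \<in> borel_measurable lebesgue" unfolding \<sigma>_def by measurable
  let ?m = "\<integral>\<^sup>+y\<in>B. w y \<partial>lebesgue"
  \<comment> \<open>Written as an upper bound on x alone, the estimate passes to the supremum over
    the truncations.\<close>
  have iff: "x \<le> ennreal_rpow (A / ?m) (1 / (p - 1)) \<longleftrightarrow> ennreal_rpow x (p - 1) * ?m \<le> A" for x
    using ennreal_le_mult_rpow_iff[of "p - 1" 1 ?m x A] p m by simp
  have "(\<integral>\<^sup>+y\<in>B. min (\<sigma> y) (of_nat n) \<partial>lebesgue) \<le> ennreal_rpow (A / ?m) (1 / (p - 1))" for n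
  proof -
    define g where "g y = min (\<sigma> y) (of_nat n)" for y
    have g [measurable]: "g \<in> borel_measurable lebesgue" unfolding g_def by measurable
    define G where "G = (\<integral>\<^sup>+y\<in>B. g y \<partial>lebesgue)"
    have "G \<le> (\<integral>\<^sup>+y. of_nat n * indicator B y \<partial>lebesgue)"
      unfolding G_def by (intro nn_integral_mono mult_right_mono) (auto simp: g_def)
    also have "\<dots> < \<infinity>"
      using B by (simp add: nn_integral_cmult_indicator ennreal_mult_less_top of_nat_less_top)
    finally have G_fin: "G < \<infinity>" .
    have "ennreal_rpow G p * ?m \<le> A * (\<integral>\<^sup>+y\<in>B. ennreal_rpow (g y) p * w y \<partial>lebesgue)"
      unfolding G_def by (rule le[OF g])
    also have "\<dots> \<le> A * G"
      unfolding G_def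
      by (intro mult_left_mono nn_integral_mono mult_right_mono dual_weight_truncation_le[OF p])
         (auto simp: g_def \<sigma>_def)
    finally have "G * (ennreal_rpow G (p - 1) * ?m) \<le> G * A"
      using ennreal_rpow_add[of 1 "p - 1" G] p by (simp add: mult.assoc mult.commute[of A])
    then have "ennreal_rpow G (p - 1) * ?m \<le> A"
      using G_fin p by (cases "G = 0") (auto simp: ennreal_mult_le_mult_iff)
    then show ?thesis
      unfolding iff G_def g_def .
  qed
  then have "(\<integral>\<^sup>+y\<in>B. \<sigma> y \<partial>lebesgue) \<le> ennreal_rpow (A / ?m) (1 / (p - 1))"
    unfolding nn_integral_truncate[OF \<sigma> B(1)] by (intro SUP_least)
  then show ?thesis
    unfolding iff \<sigma>_def .
qed

text \<open>Hoelder's inequality up to the constant: integrate the preceding bound and choose $t$ such that the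
  first term equals half of the integral of $g$, which is then absorbed.\<close>

lemma set_nn_integral_dual_le:
  assumes s: "0 < s" and w: "w \<in> borel_measurable lebesgue" and B: "B \<in> sets lebesgue"
    and m: "0 < (\<integral>\<^sup>+y\<in>B. w y \<partial>lebesgue)" "(\<integral>\<^sup>+y\<in>B. w y \<partial>lebesgue) < \<infinity>"
    and g: "g \<in> borel_measurable lebesgue"
  shows "ennreal_rpow (\<integral>\<^sup>+y\<in>B. g y \<partial>lebesgue) (1 + s)
    \<le> ennreal (2 powr (1 + s)) * ennreal_rpow (\<integral>\<^sup>+y\<in>B. w y \<partial>lebesgue) s
       * (\<integral>\<^sup>+y\<in>B. ennreal_rpow (g y) (1 + s) * ennreal_rpow (w y) (- s) \<partial>lebesgue)"
proof -
  note [measurable] = w B g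
  define G where "G = (\<integral>\<^sup>+y\<in>B. g y \<partial>lebesgue)"
  define K where "K = (\<integral>\<^sup>+y\<in>B. ennreal_rpow (g y) (1 + s) * ennreal_rpow (w y) (- s) \<partial>lebesgue)"
  obtain \<mu> where \<mu>: "(\<integral>\<^sup>+y\<in>B. w y \<partial>lebesgue) = ennreal \<mu>" "0 < \<mu>"
    using m by (cases "\<integral>\<^sup>+y\<in>B. w y \<partial>lebesgue" rule: ennreal_zero_top_cases) auto
  have split: "G \<le> ennreal t * ennreal \<mu> + ennreal (t powr - s) * K" if t: "0 < t" for t
  proof -
    have "G \<le> (\<integral>\<^sup>+y. ennreal t * (w y * indicator B y)
        + ennreal (t powr - s) * (ennreal_rpow (g y) (1 + s) * ennreal_rpow (w y) (- s) * indicator B y) \<partial>lebesgue)"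
      unfolding G_def using weight_dual_weight_split[OF s t]
      by (intro nn_integral_mono) (auto split: split_indicator)
    also have "\<dots> = ennreal t * ennreal \<mu> + ennreal (t powr - s) * K"
      unfolding K_def \<mu>(1)[symmetric] by (simp add: nn_integral_add nn_integral_cmult)
    finally show ?thesis .
  qed
  have "ennreal_rpow G (1 + s) \<le> ennreal (2 powr (1 + s)) * ennreal (\<mu> powr s) * K"
  proof (cases "K = top \<or> G = 0")
    case True
    then show ?thesis using s \<mu> by (auto simp: ennreal_mult_top ennreal_eq_0_iff)
  next
    case False
    then obtain \<kappa> where \<kappa>: "K = ennreal \<kappa>" "0 \<le> \<kappa>" by (cases K) auto
    \<comment> \<open>The absorption below subtracts half of G from both sides, so G must be finite;
      t = 1 already shows this.\<close>
    have "G < top"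
      using split[of 1] \<kappa> \<mu> by (auto simp: less_top[symmetric] top_unique simp flip: ennreal_plus)
    then obtain \<gamma> where \<gamma>: "G = ennreal \<gamma>" "0 < \<gamma>"
      using False by (cases G rule: ennreal_zero_top_cases) auto
    define t where "t = \<gamma> / (2 * \<mu>)"
    have t: "0 < t" using \<gamma> \<mu> by (simp add: t_def)
    have "ennreal \<gamma> \<le> ennreal (t * \<mu> + t powr - s * \<kappa>)"
      using split[OF t] \<gamma> \<kappa> \<mu> t by (simp add: ennreal_mult)
    then have "\<gamma> \<le> t * \<mu> + t powr - s * \<kappa>"
      using \<kappa> \<mu> t by (subst (asm) ennreal_le_iff) auto
    then have "\<gamma> / 2 \<le> t powr - s * \<kappa>"
      using \<mu> by (simp add: t_def)
    then have "t powr s * (\<gamma> / 2) \<le> t powr s * (t powr - s * \<kappa>)"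
      by (intro mult_left_mono) auto
    also have "\<dots> = \<kappa>"
      using t by (simp add: powr_minus field_simps)
    finally have "\<gamma> / 2 * t powr s * (2 powr (1 + s) * \<mu> powr s) \<le> \<kappa> * (2 powr (1 + s) * \<mu> powr s)"
      by (intro mult_right_mono) (auto simp: mult.commute)
    moreover have "\<gamma> / 2 * t powr s * (2 powr (1 + s) * \<mu> powr s) = \<gamma> powr (1 + s)"
      using \<gamma> \<mu> by (simp add: t_def powr_divide powr_mult powr_add field_simps)
    ultimately have "\<gamma> powr (1 + s) \<le> 2 powr (1 + s) * \<mu> powr s * \<kappa>"
      by (simp add: mult.commute)
    then show ?thesis
      using \<gamma> \<kappa> by (simp add: ennreal_rpow_ennreal flip: ennreal_mult)
  qed
  then show ?thesis
    using \<mu> by (simp add: G_def K_def ennreal_rpow_ennreal)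
qed

text \<open>With s = 1/(p-1) the conjugate exponent is 1+s and the dual weight is w^(-s). Let m and
  S be the integrals of w and w^(-s) over the ball. The bound S^(p-1) m <= C r^p, raised to the
  power s, becomes m^s S <= C^s r^(1+s), which controls the factor m^s of
  \<open>set_nn_integral_dual_le\<close> after multiplication by S. The same bound with m > 0 makes
  S finite.\<close>

lemma muckenhoupt_within_dual:
  assumes p: "1 < p" and w: "w \<in> borel_measurable lebesgue"
    and m: "\<And>x r. 0 < r \<Longrightarrow> 0 < (\<integral>\<^sup>+y\<in>ball x r. w y \<partial>lebesgue)" "\<And>x r. 0 < r \<Longrightarrow> (\<integral>\<^sup>+y\<in>ball x r. w y \<partial>lebesgue) < \<infinity>"
    and A: "muckenhoupt_within p w B0"
  shows "muckenhoupt_within (p / (p - 1)) (\<lambda>y. ennreal_rpow (w y) (1 / (1 - p))) B0"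
    and "0 < r \<Longrightarrow> ball x r \<subseteq> B0 \<Longrightarrow> (\<integral>\<^sup>+y\<in>ball x r. ennreal_rpow (w y) (1 / (1 - p)) \<partial>lebesgue) < \<infinity>"
proof -
  define s where "s = 1 / (p - 1)"
  have s: "0 < s" "p / (p - 1) = 1 + s" "1 / (1 - p) = - s" "(p - 1) * s = 1" "p * s = 1 + s"
    using p by (auto simp: s_def field_simps)
  obtain C where C: "0 < C" and le: "\<And>x r g. 0 < r \<Longrightarrow> ball x r \<subseteq> B0 \<Longrightarrow> g \<in> borel_measurable lebesgue \<Longrightarrow>
      ennreal_rpow (\<integral>\<^sup>+y\<in>ball x r. g y \<partial>lebesgue) p * (\<integral>\<^sup>+y\<in>ball x r. w y \<partial>lebesgue)
      \<le> ennreal (C * r powr p) * (\<integral>\<^sup>+y\<in>ball x r. ennreal_rpow (g y) p * w y \<partial>lebesgue)"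
    using muckenhoupt_withinE[OF A] by blast
  have S: "ennreal_rpow (\<integral>\<^sup>+y\<in>ball x r. ennreal_rpow (w y) (- s) \<partial>lebesgue) (p - 1)
           * (\<integral>\<^sup>+y\<in>ball x r. w y \<partial>lebesgue) \<le> ennreal (C * r powr p)"
    if "0 < r" "ball x r \<subseteq> B0" for x r
    using dual_weight_ball_le[OF p w _ _ m[OF that(1)] le[OF that]] that
    by (simp add: s(3) ball_eq_greaterThanLessThan)
  show "(\<integral>\<^sup>+y\<in>ball x r. ennreal_rpow (w y) (1 / (1 - p)) \<partial>lebesgue) < \<infinity>" if "0 < r" "ball x r \<subseteq> B0"
  proof (rule ccontr)
    assume "\<not> (\<integral>\<^sup>+y\<in>ball x r. ennreal_rpow (w y) (1 / (1 - p)) \<partial>lebesgue) < \<infinity>"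
    then have "(\<integral>\<^sup>+y\<in>ball x r. ennreal_rpow (w y) (- s) \<partial>lebesgue) = top"
      by (simp add: s(3) less_top[symmetric])
    with S[OF that] m(1)[OF that(1), of x] p show False
      by (auto simp: ennreal_top_mult top_unique split: if_splits)
  qed
  show "muckenhoupt_within (p / (p - 1)) (\<lambda>y. ennreal_rpow (w y) (1 / (1 - p))) B0"
    unfolding s(2,3)
  proof (rule muckenhoupt_withinI)
    show "0 < 2 powr (1 + s) * C powr s" using C by simp
    fix x r and g :: "real \<Rightarrow> ennreal"
    assume r: "0 < r" and sub: "ball x r \<subseteq> B0" and g: "g \<in> borel_measurable lebesgue"
    let ?B = "ball x r"
    let ?m = "\<integral>\<^sup>+y\<in>?B. w y \<partial>lebesgue" and ?S = "\<integral>\<^sup>+y\<in>?B. ennreal_rpow (w y) (- s) \<partial>lebesgue"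
    let ?K = "\<integral>\<^sup>+y\<in>?B. ennreal_rpow (g y) (1 + s) * ennreal_rpow (w y) (- s) \<partial>lebesgue"
    have "ennreal_rpow ?m s * ?S = ennreal_rpow (ennreal_rpow ?S (p - 1) * ?m) s"
      using s p by (simp add: ennreal_rpow_mult ennreal_rpow_rpow mult.commute)
    also have "\<dots> \<le> ennreal_rpow (ennreal (C * r powr p)) s"
      by (intro ennreal_rpow_mono s S r sub)
    also have "\<dots> = ennreal (C powr s * r powr (1 + s))"
      using C r by (simp add: ennreal_rpow_ennreal powr_mult powr_powr s(5))
    finally have mS: "ennreal_rpow ?m s * ?S \<le> ennreal (C powr s * r powr (1 + s))" .
    have "ennreal_rpow (\<integral>\<^sup>+y\<in>?B. g y \<partial>lebesgue) (1 + s) * ?S \<le> ennreal (2 powr (1 + s)) * ennreal_rpow ?m s * ?K * ?S"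
      by (intro mult_right_mono set_nn_integral_dual_le s w m r g) auto
    also have "\<dots> = ennreal (2 powr (1 + s)) * (ennreal_rpow ?m s * ?S) * ?K"
      by (simp only: mult_ac)
    also have "\<dots> \<le> ennreal (2 powr (1 + s)) * ennreal (C powr s * r powr (1 + s)) * ?K"
      by (intro mult_right_mono mult_left_mono mS) auto
    also have "\<dots> = ennreal (2 powr (1 + s) * C powr s * r powr (1 + s)) * ?K"
      by (simp add: ennreal_mult mult.assoc)
    finally show "ennreal_rpow (\<integral>\<^sup>+y\<in>?B. g y \<partial>lebesgue) (1 + s) * ?S
        \<le> ennreal (2 powr (1 + s) * C powr s * r powr (1 + s)) * ?K" .
  qed
qed

text \<open>For the dual weight, finiteness is known on small balls only; finitely many of them
  cover the compact closed ball.\<close>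

lemma set_nn_integral_ball_finite_if_locally_finite:
  fixes f :: "real \<Rightarrow> ennreal"
  assumes f: "f \<in> borel_measurable lebesgue"
    and loc: "\<And>x. \<exists>R>0. (\<integral>\<^sup>+y\<in>ball x R. f y \<partial>lebesgue) < \<infinity>"
  shows "(\<integral>\<^sup>+y\<in>ball x r. f y \<partial>lebesgue) < \<infinity>"
proof -
  let ?N = "density lebesgue f"
  have N: "emeasure ?N A = (\<integral>\<^sup>+y\<in>A. f y \<partial>lebesgue)" if "A \<in> sets lebesgue" for A
    using f that by (simp add: emeasure_density)
  obtain R where R: "\<And>x. 0 < R x" "\<And>x. (\<integral>\<^sup>+y\<in>ball x (R x). f y \<partial>lebesgue) < \<infinity>"
    using loc by metis
  obtain F where F: "finite F" "cball x r \<subseteq> (\<Union>y\<in>F. ball y (R y))"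
  proof (rule compactE_image[of "cball x r" UNIV "\<lambda>y. ball y (R y)"])
    show "cball x r \<subseteq> (\<Union>y\<in>UNIV. ball y (R y))" using R(1) by (meson UN_I UNIV_I centre_in_ball subsetI)
  qed auto
  have "emeasure ?N (ball x r) \<le> emeasure ?N (\<Union>y\<in>F. ball y (R y))"
    using F ball_subset_cball by (intro emeasure_mono) (auto intro!: sets.finite_UN)
  also have "\<dots> \<le> (\<Sum>y\<in>F. emeasure ?N (ball y (R y)))"
    using F by (intro emeasure_subadditive_finite) auto
  also have "\<dots> < \<infinity>"
    using R(2) F by (simp add: N ennreal_sum_less_top)
  finally show ?thesis by (simp add: N)
qed

section \<open>Local admissibility of the maximum, the minimum and the dual weight\<close>

lemma locally_admissible_weight_max:
  assumes p: "1 \<le> p" and w: "locally_admissible_weight p w1" "locally_admissible_weight p w2"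
  shows "locally_admissible_weight p (\<lambda>x. max (w1 x) (w2 x))"
proof -
  note w' = w[unfolded locally_admissible_weight_iff_muckenhoupt[OF p]]
  have [measurable]: "w1 \<in> borel_measurable lebesgue" "w2 \<in> borel_measurable lebesgue"
    using w' by auto
  show ?thesis
    unfolding locally_admissible_weight_iff_muckenhoupt[OF p]
  proof (intro conjI allI impI)
    fix x r :: real assume r: "0 < r"
    have "(\<integral>\<^sup>+y\<in>ball x r. w1 y \<partial>lebesgue) \<le> (\<integral>\<^sup>+y\<in>ball x r. max (w1 y) (w2 y) \<partial>lebesgue)"
      by (intro nn_integral_mono mult_right_mono) auto
    then show "0 < (\<integral>\<^sup>+y\<in>ball x r. max (w1 y) (w2 y) \<partial>lebesgue)"
      using w'(1) r by (meson less_le_trans)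
    have "(\<integral>\<^sup>+y\<in>ball x r. max (w1 y) (w2 y) \<partial>lebesgue) \<le> (\<integral>\<^sup>+y. w1 y * indicator (ball x r) y + w2 y * indicator (ball x r) y \<partial>lebesgue)"
      by (intro nn_integral_mono) (auto simp: max_def split: split_indicator)
    also have "\<dots> = (\<integral>\<^sup>+y\<in>ball x r. w1 y \<partial>lebesgue) + (\<integral>\<^sup>+y\<in>ball x r. w2 y \<partial>lebesgue)"
      by (subst nn_integral_add) auto
    also have "\<dots> < \<infinity>"
      using w' r by (simp add: ennreal_add_less_top)
    finally show "(\<integral>\<^sup>+y\<in>ball x r. max (w1 y) (w2 y) \<partial>lebesgue) < \<infinity>" .
  next
    fix x
    obtain R1 R2 where R: "0 < R1" "0 < R2" "muckenhoupt_within p w1 (ball x R1)" "muckenhoupt_within p w2 (ball x R2)"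
      using w' by meson
    have "muckenhoupt_within p (\<lambda>y. max (w1 y) (w2 y)) (ball x (min R1 R2))"
      by (intro muckenhoupt_within_max muckenhoupt_within_subset[OF R(3)] muckenhoupt_within_subset[OF R(4)] subset_ball) auto
    then show "\<exists>R>0. muckenhoupt_within p (\<lambda>y. max (w1 y) (w2 y)) (ball x R)"
      using R(1,2) by (intro exI[of _ "min R1 R2"]) simp
  qed measurable
qed

lemma locally_admissible_weight_AE_pos:
  assumes p: "1 \<le> p" and w: "locally_admissible_weight p w"
  obtains R where "0 < R" "AE y in lebesgue. y \<in> ball x R \<longrightarrow> 0 < w y"
proof -
  note w' = w[unfolded locally_admissible_weight_iff_muckenhoupt[OF p]]
  obtain R where R: "0 < R" "muckenhoupt_within p w (ball x R)" using w' by blast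
  then show thesis
    using w' by (intro that[of R] AE_pos_if_muckenhoupt_within[OF p]) auto
qed

lemma locally_admissible_weight_min:
  assumes p: "1 \<le> p" and w: "locally_admissible_weight p w1" "locally_admissible_weight p w2"
  shows "locally_admissible_weight p (\<lambda>x. min (w1 x) (w2 x))"
proof -
  note w' = w[unfolded locally_admissible_weight_iff_muckenhoupt[OF p]]
  have [measurable]: "w1 \<in> borel_measurable lebesgue" "w2 \<in> borel_measurable lebesgue"
    using w' by auto
  show ?thesis
    unfolding locally_admissible_weight_iff_muckenhoupt[OF p]
  proof (intro conjI allI impI)
    fix x r :: real assume r: "0 < r"
    obtain R1 where R1: "0 < R1" "AE y in lebesgue. y \<in> ball x R1 \<longrightarrow> 0 < w1 y"
      using locally_admissible_weight_AE_pos[OF p w(1)] .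
    obtain R2 where R2: "0 < R2" "AE y in lebesgue. y \<in> ball x R2 \<longrightarrow> 0 < w2 y"
      using locally_admissible_weight_AE_pos[OF p w(2)] .
    \<comment> \<open>Positive integrals of w1 and w2 alone say nothing about the minimum; on this
      smaller ball both weights are positive a.e.\<close>
    define \<rho> where "\<rho> = min r (min R1 R2)"
    have "AE y in lebesgue. y \<in> ball x \<rho> \<longrightarrow> 0 < min (w1 y) (w2 y)"
      using R1(2) R2(2) by eventually_elim (auto simp: \<rho>_def)
    then have "0 < (\<integral>\<^sup>+y\<in>ball x \<rho>. min (w1 y) (w2 y) \<partial>lebesgue)"
      using r R1(1) R2(1) by (intro set_nn_integral_ball_pos) (auto simp: \<rho>_def)
    also have "\<dots> \<le> (\<integral>\<^sup>+y\<in>ball x r. min (w1 y) (w2 y) \<partial>lebesgue)"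
      by (intro nn_integral_mono) (auto simp: \<rho>_def split: split_indicator)
    finally show "0 < (\<integral>\<^sup>+y\<in>ball x r. min (w1 y) (w2 y) \<partial>lebesgue)" .
    have "(\<integral>\<^sup>+y\<in>ball x r. min (w1 y) (w2 y) \<partial>lebesgue) \<le> (\<integral>\<^sup>+y\<in>ball x r. w1 y \<partial>lebesgue)"
      by (intro nn_integral_mono mult_right_mono) auto
    then show "(\<integral>\<^sup>+y\<in>ball x r. min (w1 y) (w2 y) \<partial>lebesgue) < \<infinity>"
      using w'(1) r by (meson le_less_trans)
  next
    fix x
    obtain R1 R2 where R: "0 < R1" "0 < R2" "muckenhoupt_within p w1 (ball x R1)" "muckenhoupt_within p w2 (ball x R2)"
      using w' by meson
    have "muckenhoupt_within p (\<lambda>y. min (w1 y) (w2 y)) (ball x (min R1 R2))"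
      by (intro muckenhoupt_within_min[OF p] muckenhoupt_within_subset[OF R(3)] muckenhoupt_within_subset[OF R(4)] subset_ball) auto
    then show "\<exists>R>0. muckenhoupt_within p (\<lambda>y. min (w1 y) (w2 y)) (ball x R)"
      using R(1,2) by (intro exI[of _ "min R1 R2"]) simp
  qed measurable
qed

lemma locally_admissible_weight_dual:
  assumes p: "1 < p" and w: "locally_admissible_weight p w"
  shows "locally_admissible_weight (p / (p - 1)) (\<lambda>x. ennreal_rpow (w x) (1 / (1 - p)))"
proof -
  have p1: "1 \<le> p" and q1: "1 \<le> p / (p - 1)" using p by auto
  note w' = w[unfolded locally_admissible_weight_iff_muckenhoupt[OF p1]]
  let ?\<sigma> = "\<lambda>x. ennreal_rpow (w x) (1 / (1 - p))"
  have m: "0 < (\<integral>\<^sup>+y\<in>ball x r. w y \<partial>lebesgue)" "(\<integral>\<^sup>+y\<in>ball x r. w y \<partial>lebesgue) < \<infinity>" if "0 < r" for x r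
    using w' that by auto
  have wm [measurable]: "w \<in> borel_measurable lebesgue" using w' by auto
  have \<sigma>m: "?\<sigma> \<in> borel_measurable lebesgue" by measurable
  note dual = muckenhoupt_within_dual[OF p wm m]
  show ?thesis
    unfolding locally_admissible_weight_iff_muckenhoupt[OF q1]
  proof (intro conjI allI impI)
    show "?\<sigma> \<in> borel_measurable lebesgue" by (rule \<sigma>m)
    show "\<exists>R>0. muckenhoupt_within (p / (p - 1)) ?\<sigma> (ball x R)" for x
      using w' dual(1) by blast
    fix x r :: real assume r: "0 < r"
    have "\<exists>R>0. (\<integral>\<^sup>+y\<in>ball x R. ?\<sigma> y \<partial>lebesgue) < \<infinity>" for x
      using w' dual(2) by (meson order_refl)
    then show "(\<integral>\<^sup>+y\<in>ball x r. ?\<sigma> y \<partial>lebesgue) < \<infinity>"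
      by (rule set_nn_integral_ball_finite_if_locally_finite[OF \<sigma>m])
    \<comment> \<open>The dual weight vanishes exactly where w is infinite, and finite integrals of
      w over balls confine this to a null set.\<close>
    have "AE y in lebesgue. w y * indicator (ball x r) y \<noteq> \<infinity>"
      using m(2)[OF r, of x] by (intro nn_integral_noteq_infinite) auto
    then have "AE y in lebesgue. y \<in> ball x r \<longrightarrow> 0 < ?\<sigma> y"
    proof eventually_elim
      case (elim y)
      then show ?case
        using p by (cases "w y" rule: ennreal_zero_top_cases) (auto simp: ennreal_rpow_def)
    qed
    then show "0 < (\<integral>\<^sup>+y\<in>ball x r. ?\<sigma> y \<partial>lebesgue)"
      by (rule set_nn_integral_ball_pos[OF \<sigma>m r])
  qed
qed

theorem corollary5p2:
  fixes p :: real and w1 w2 :: "real \<Rightarrow> ennreal"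
  assumes "1 \<le> p"
    and "locally_admissible_weight p w1"
    and "locally_admissible_weight p w2"
  shows "locally_admissible_weight p (\<lambda>x. max (w1 x) (w2 x)) \<and>
         locally_admissible_weight p (\<lambda>x. min (w1 x) (w2 x)) \<and>
         (1 < p \<longrightarrow> locally_admissible_weight (p / (p - 1)) (\<lambda>x. ennreal_rpow (w1 x) (1 / (1 - p))))"
  using assms locally_admissible_weight_max locally_admissible_weight_min locally_admissible_weight_dual by blast

end
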